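(* Let $(X,\mathfrak{S})$ be a hierarchically hyperbolic space and let $A,B\subseteq X$ be $\kappa$-hierarchically quasiconvex subspaces. Then $A$ and $B$ fill all squares for some constant $T\ge0$ if and only if $A\cup B$ is $\widetilde\kappa$-hierarchically quasiconvex for some function $\widetilde\kappa$. Moreover, $T$ and $\widetilde\kappa$ each determine the other, together with $\kappa$, $\mathrm{d}_X(A,B)$ and $(X,\mathfrak{S})$: if $A\cup B$ is $\widetilde\kappa$-hierarchically quasiconvex then $A,B$ fill all squares with a constant $T$ depending only on $(X,\mathfrak{S})$, $\kappa$, $\widetilde\kappa$; and if $A,B$ fill all squares with constant $T$ then $A\cup B$ is $\widetilde\kappa$-hierarchically quasiconvex with $\widetilde\kappa$ depending only on $(X,\mathfrak{S})$, $\kappa$, $\mathrm{d}_X(A,B)$, $T$.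
   Context: A hierarchically hyperbolic space (HHS) $(X,\mathfrak{S})$ with constant $E>0$ is a hierarchical space in the sense of Behrstock–Hagen–Sisto (a quasigeodesic space $X$, a set $\mathfrak{S}$ of domains with nesting $\sqsubseteq$, orthogonality $\bot$, transversality $\pitchfork$, geodesic coordinate spaces $\mathcal C U$, $(E,E)$-coarsely Lipschitz projections $\pi_U\colon X\to 2^{\mathcal C U}$ with images of diameter $\le E$, relative projections $\rho^V_U$, satisfying the axioms of projections, nesting, orthogonality with containers, transversality and consistency, finite complexity, large links, bounded geodesic image, partial realisation, uniqueness) in which every $\mathcal C U$ is $E$-hyperbolic. Notation: $\mathrm{d}_U(P,Q)=\mathrm{d}_{\mathcal C U}(\pi_U(P),\pi_U(Q))$. A subset $Y\subseteq X$ is $\kappa$-hierarchically quasiconvex, for $\kappa\colon[0,\infty)\to[0,\infty)$, if $\pi_U(Y)$ is $\kappa(0)$-quasiconvex in $\mathcal C U$ for every $U\in\mathfrak{S}$, and for every $x\in X$ and $R\ge0$, if $\mathrm{d}_U(x,Y)\le R$ for all $U\in\mathfrak{S}$ then $\mathrm{d}_X(x,Y)\le\kappa(R)$. For a hierarchically quasiconvex $Y$, the gate $\mathfrak g_Y\colon X\to Y$ is a coarsely Lipschitz coarse retraction such that for all $x\in X$ and $W\in\mathfrak{S}$, $\pi_W(\mathfrak g_Y(x))$ uniformly coarsely coincides with the coarse closest point projection of $\pi_W(x)$ to $\pi_W(Y)$. For $P\subseteq Q$, $P$ is $T$-dense in $Q$ if $Q$ lies in the $T$-neighbourhood of $P$.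 Two subsets $A,B$ fill all squares (with constant $T$) if for every pair of orthogonal domains $U\bot V$, either $\pi_U(\mathfrak g_A(B))$ is $T$-dense in $\pi_U(A)$, or $\pi_V(\mathfrak g_B(A))$ is $T$-dense in $\pi_V(B)$. *)

theory Defs
  imports "HOL-Analysis.Analysis"
begin

definition metric_on :: "'c set \<Rightarrow> ('c \<Rightarrow> 'c \<Rightarrow> real) \<Rightarrow> bool" where
  "metric_on M d \<longleftrightarrow>
     (\<forall>x\<in>M. \<forall>y\<in>M. 0 \<le> d x y \<and> (d x y = 0 \<longleftrightarrow> x = y) \<and> d x y = d y x) \<and>
     (\<forall>x\<in>M. \<forall>y\<in>M. \<forall>z\<in>M. d x z \<le> d x y + d y z)"

definition geodesic_seg :: "'c set \<Rightarrow> ('c \<Rightarrow> 'c \<Rightarrow> real) \<Rightarrow> (real \<Rightarrow> 'c) \<Rightarrow> 'c \<Rightarrow> 'c \<Rightarrow> bool" where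
  "geodesic_seg M d \<gamma> a b \<longleftrightarrow>
     \<gamma> ` {0..d a b} \<subseteq> M \<and> \<gamma> 0 = a \<and> \<gamma> (d a b) = b \<and>
     (\<forall>s\<in>{0..d a b}. \<forall>t\<in>{0..d a b}. d (\<gamma> s) (\<gamma> t) = \<bar>s - t\<bar>)"

definition geodesic_space :: "'c set \<Rightarrow> ('c \<Rightarrow> 'c \<Rightarrow> real) \<Rightarrow> bool" where
  "geodesic_space M d \<longleftrightarrow> (\<forall>a\<in>M. \<forall>b\<in>M. \<exists>\<gamma>. geodesic_seg M d \<gamma> a b)"

definition gromov_prod :: "('c \<Rightarrow> 'c \<Rightarrow> real) \<Rightarrow> 'c \<Rightarrow> 'c \<Rightarrow> 'c \<Rightarrow> real" where
  "gromov_prod d w x y = (d w x + d w y - d x y) / 2"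

definition hyperbolic :: "'c set \<Rightarrow> ('c \<Rightarrow> 'c \<Rightarrow> real) \<Rightarrow> real \<Rightarrow> bool" where
  "hyperbolic M d \<delta> \<longleftrightarrow>
     (\<forall>w\<in>M. \<forall>x\<in>M. \<forall>y\<in>M. \<forall>z\<in>M.
        gromov_prod d w x y \<ge> min (gromov_prod d w x z) (gromov_prod d w y z) - \<delta>)"

definition diam_le :: "('c \<Rightarrow> 'c \<Rightarrow> real) \<Rightarrow> 'c set \<Rightarrow> real \<Rightarrow> bool" where
  "diam_le d P r \<longleftrightarrow> (\<forall>x\<in>P. \<forall>y\<in>P. d x y \<le> r)"

text \<open>distance between two subsets (infimal distance); 0 if one of them is empty
  (same convention as the library's setdist)\<close>
definition csetdist :: "('c \<Rightarrow> 'c \<Rightarrow> real) \<Rightarrow> 'c set \<Rightarrow> 'c set \<Rightarrow> real" where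
  "csetdist d P Q = (if P = {} \<or> Q = {} then 0 else Inf {d x y | x y. x \<in> P \<and> y \<in> Q})"

definition quasiconvex :: "'c set \<Rightarrow> ('c \<Rightarrow> 'c \<Rightarrow> real) \<Rightarrow> real \<Rightarrow> 'c set \<Rightarrow> bool" where
  "quasiconvex M d k Y \<longleftrightarrow> Y \<subseteq> M \<and>
     (\<forall>a\<in>Y. \<forall>b\<in>Y. \<forall>\<gamma>. geodesic_seg M d \<gamma> a b \<longrightarrow>
        (\<forall>t\<in>{0..d a b}. \<exists>y\<in>Y. d (\<gamma> t) y \<le> k))"

definition dense_in :: "('c \<Rightarrow> 'c \<Rightarrow> real) \<Rightarrow> real \<Rightarrow> 'c set \<Rightarrow> 'c set \<Rightarrow> bool" where
  "dense_in d T P Q \<longleftrightarrow> (\<forall>q\<in>Q. \<exists>p\<in>P. d p q \<le> T)"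

definition hausdorff_le :: "('c \<Rightarrow> 'c \<Rightarrow> real) \<Rightarrow> 'c set \<Rightarrow> 'c set \<Rightarrow> real \<Rightarrow> bool" where
  "hausdorff_le d P Q C \<longleftrightarrow> dense_in d C P Q \<and> dense_in d C Q P"

definition cpp :: "('c \<Rightarrow> 'c \<Rightarrow> real) \<Rightarrow> 'c set \<Rightarrow> 'c set \<Rightarrow> 'c set" where
  "cpp d Y P = {y \<in> Y. \<exists>z\<in>P. d z y \<le> csetdist d {z} Y + 1}"

definition quasigeodesic_space :: "'x::metric_space itself \<Rightarrow> real \<Rightarrow> bool" where
  "quasigeodesic_space _ E \<longleftrightarrow>
     (\<forall>x y::'x. \<exists>L\<ge>0. \<exists>\<gamma>. \<gamma> 0 = x \<and> \<gamma> L = y \<and>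
        (\<forall>s\<in>{0..L}. \<forall>t\<in>{0..L}.
           \<bar>s - t\<bar> / E - E \<le> dist (\<gamma> s) (\<gamma> t) \<and> dist (\<gamma> s) (\<gamma> t) \<le> E * \<bar>s - t\<bar> + E))"

text \<open>Data of a hierarchical structure on a metric space of type 'x:
  domains Dom (the index set \<frak>S), nesting, orthogonality, coordinate spaces
  (carrier CS U with distance dC U), projections pr U x \<subseteq> CS U,
  relative projections rho V W = \<rho>^V_W \<subseteq> CS W (for V properly nested in W or V transverse to W)
  and downward relative projections rhod W V = \<rho>^W_V : CS W \<rightarrow> 2^(CS V) (for V properly nested in W).\<close>
record ('d, 'x, 'c) hstruct =
  Dom  :: "'d set"
  nest :: "'d \<Rightarrow> 'd \<Rightarrow> bool"
  orth :: "'d \<Rightarrow> 'd \<Rightarrow> bool"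
  CS   :: "'d \<Rightarrow> 'c set"
  dC   :: "'d \<Rightarrow> 'c \<Rightarrow> 'c \<Rightarrow> real"
  pr   :: "'d \<Rightarrow> 'x \<Rightarrow> 'c set"
  rho  :: "'d \<Rightarrow> 'd \<Rightarrow> 'c set"
  rhod :: "'d \<Rightarrow> 'd \<Rightarrow> 'c \<Rightarrow> 'c set"

definition transverse :: "('d, 'x, 'c, 'e) hstruct_scheme \<Rightarrow> 'd \<Rightarrow> 'd \<Rightarrow> bool" where
  "transverse H V W \<longleftrightarrow> \<not> orth H V W \<and> \<not> nest H V W \<and> \<not> nest H W V"

definition prset :: "('d, 'x, 'c, 'e) hstruct_scheme \<Rightarrow> 'd \<Rightarrow> 'x set \<Rightarrow> 'c set" where
  "prset H U Y = (\<Union>y\<in>Y. pr H U y)"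

definition dU :: "('d, 'x, 'c, 'e) hstruct_scheme \<Rightarrow> 'd \<Rightarrow> 'x set \<Rightarrow> 'x set \<Rightarrow> real" where
  "dU H U P Q = csetdist (dC H U) (prset H U P) (prset H U Q)"

text \<open>The axioms of a hierarchically hyperbolic space (Behrstock--Hagen--Sisto),
  all constants taken equal to a single E, and uniqueness function \<theta>.\<close>
definition HHS_with :: "('d, 'x::metric_space, 'c, 'e) hstruct_scheme \<Rightarrow> real \<Rightarrow> (real \<Rightarrow> real) \<Rightarrow> bool" where
  "HHS_with H E \<theta> \<longleftrightarrow> E > 0 \<and>
    \<comment> \<open>X is a quasigeodesic space\<close>
    quasigeodesic_space TYPE('x) E \<and>
    \<comment> \<open>(1) projections; coordinate spaces geodesic and E-hyperbolic\<close>
    (\<forall>U\<in>Dom H. metric_on (CS H U) (dC H U) \<and> geodesic_space (CS H U) (dC H U) \<and>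
        hyperbolic (CS H U) (dC H U) E) \<and>
    (\<forall>U\<in>Dom H. \<forall>x. pr H U x \<noteq> {} \<and> pr H U x \<subseteq> CS H U \<and> diam_le (dC H U) (pr H U x) E) \<and>
    (\<forall>U\<in>Dom H. \<forall>x y. diam_le (dC H U) (pr H U x \<union> pr H U y) (E * dist x y + E)) \<and>
    (\<forall>U\<in>Dom H. quasiconvex (CS H U) (dC H U) E (prset H U UNIV)) \<and>
    \<comment> \<open>(2) nesting\<close>
    (\<forall>U\<in>Dom H. nest H U U) \<and>
    (\<forall>U\<in>Dom H. \<forall>V\<in>Dom H. nest H U V \<and> nest H V U \<longrightarrow> U = V) \<and>
    (\<forall>U\<in>Dom H. \<forall>V\<in>Dom H. \<forall>W\<in>Dom H. nest H U V \<and> nest H V W \<longrightarrow> nest H U W) \<and>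
    (Dom H \<noteq> {} \<longrightarrow> (\<exists>!M. M \<in> Dom H \<and> (\<forall>U\<in>Dom H. nest H M U \<longrightarrow> U = M))) \<and>
    (\<forall>V\<in>Dom H. \<forall>W\<in>Dom H. nest H V W \<and> V \<noteq> W \<longrightarrow>
        rho H V W \<noteq> {} \<and> rho H V W \<subseteq> CS H W \<and> diam_le (dC H W) (rho H V W) E \<and>
        (\<forall>p\<in>CS H W. rhod H W V p \<subseteq> CS H V)) \<and>
    \<comment> \<open>(3) orthogonality and containers\<close>
    (\<forall>U\<in>Dom H. \<forall>V\<in>Dom H. orth H U V \<longrightarrow> orth H V U) \<and>
    (\<forall>U\<in>Dom H. \<not> orth H U U) \<and>
    (\<forall>U\<in>Dom H. \<forall>V\<in>Dom H. \<forall>W\<in>Dom H. nest H V W \<and> orth H W U \<longrightarrow> orth H V U) \<and>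
    (\<forall>U\<in>Dom H. \<forall>V\<in>Dom H. orth H U V \<longrightarrow> \<not> nest H U V \<and> \<not> nest H V U) \<and>
    (\<forall>T\<in>Dom H. \<forall>U\<in>Dom H. nest H U T \<and> (\<exists>V\<in>Dom H. nest H V T \<and> orth H V U) \<longrightarrow>
        (\<exists>W\<in>Dom H. nest H W T \<and> W \<noteq> T \<and>
            (\<forall>V\<in>Dom H. orth H V U \<and> nest H V T \<longrightarrow> nest H V W))) \<and>
    \<comment> \<open>(4) transversality and consistency\<close>
    (\<forall>V\<in>Dom H. \<forall>W\<in>Dom H. transverse H V W \<longrightarrow>
        rho H V W \<noteq> {} \<and> rho H V W \<subseteq> CS H W \<and> diam_le (dC H W) (rho H V W) E \<and>
        (\<forall>x. min (csetdist (dC H W) (pr H W x) (rho H V W))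
                 (csetdist (dC H V) (pr H V x) (rho H W V)) \<le> E)) \<and>
    (\<forall>V\<in>Dom H. \<forall>W\<in>Dom H. nest H V W \<and> V \<noteq> W \<longrightarrow> (\<forall>x.
        csetdist (dC H W) (pr H W x) (rho H V W) \<le> E \<or>
        diam_le (dC H V) (pr H V x \<union> (\<Union>p\<in>pr H W x. rhod H W V p)) E)) \<and>
    (\<forall>U\<in>Dom H. \<forall>V\<in>Dom H. \<forall>W\<in>Dom H.
        nest H U V \<and> ((nest H V W \<and> V \<noteq> W) \<or> (transverse H V W \<and> \<not> orth H W U)) \<longrightarrow>
        csetdist (dC H W) (rho H U W) (rho H V W) \<le> E) \<and>
    \<comment> \<open>(5) finite complexity\<close>
    (\<forall>C\<subseteq>Dom H. (\<forall>U\<in>C. \<forall>V\<in>C. nest H U V \<or> nest H V U) \<longrightarrow> finite C \<and> real (card C) \<le> E) \<and>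
    \<comment> \<open>(6) large links\<close>
    (\<forall>W\<in>Dom H. \<forall>x x'. \<exists>Ts.
        Ts \<subseteq> {T\<in>Dom H. nest H T W \<and> T \<noteq> W} \<and> finite Ts \<and>
        real (card Ts) \<le> of_int \<lfloor>E * dU H W {x} {x'} + E\<rfloor> \<and>
        (\<forall>T\<in>Dom H. nest H T W \<and> T \<noteq> W \<longrightarrow>
            (\<exists>Ti\<in>Ts. nest H T Ti) \<or> dU H T {x} {x'} < E) \<and>
        (\<forall>Ti\<in>Ts. csetdist (dC H W) (pr H W x) (rho H Ti W) \<le> E * dU H W {x} {x'} + E)) \<and>
    \<comment> \<open>(7) bounded geodesic image\<close>
    (\<forall>W\<in>Dom H. \<forall>V\<in>Dom H. nest H V W \<and> V \<noteq> W \<longrightarrow>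
       (\<forall>a\<in>CS H W. \<forall>b\<in>CS H W. \<forall>\<gamma>. geodesic_seg (CS H W) (dC H W) \<gamma> a b \<longrightarrow>
          diam_le (dC H V) (\<Union>t\<in>{0..dC H W a b}. rhod H W V (\<gamma> t)) E \<or>
          (\<exists>t\<in>{0..dC H W a b}. \<exists>p\<in>rho H V W. dC H W (\<gamma> t) p \<le> E))) \<and>
    \<comment> \<open>(8) partial realisation\<close>
    (\<forall>Vs\<subseteq>Dom H. \<forall>p. (\<forall>V\<in>Vs. \<forall>V'\<in>Vs. V \<noteq> V' \<longrightarrow> orth H V V') \<and>
        (\<forall>V\<in>Vs. p V \<in> prset H V UNIV) \<longrightarrow>
       (\<exists>x. (\<forall>V\<in>Vs. csetdist (dC H V) (pr H V x) {p V} \<le> E) \<and>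
            (\<forall>V\<in>Vs. \<forall>W\<in>Dom H. nest H V W \<and> V \<noteq> W \<longrightarrow>
                 csetdist (dC H W) (pr H W x) (rho H V W) \<le> E) \<and>
            (\<forall>V\<in>Vs. \<forall>W\<in>Dom H. transverse H W V \<longrightarrow>
                 csetdist (dC H W) (pr H W x) (rho H V W) \<le> E))) \<and>
    \<comment> \<open>(9) uniqueness\<close>
    (\<forall>k\<ge>0. \<forall>x y. dist x y \<ge> \<theta> k \<longrightarrow> (\<exists>V\<in>Dom H. dU H V {x} {y} \<ge> k))"

definition HHS :: "('d, 'x::metric_space, 'c, 'e) hstruct_scheme \<Rightarrow> bool" where
  "HHS H \<longleftrightarrow> (\<exists>E \<theta>. HHS_with H E \<theta>)"

definition hier_qconvex :: "('d, 'x::metric_space, 'c, 'e) hstruct_scheme \<Rightarrow> (real \<Rightarrow> real) \<Rightarrow> 'x set \<Rightarrow> bool" where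
  "hier_qconvex H \<kappa> Y \<longleftrightarrow>
     (\<forall>R\<ge>0. \<kappa> R \<ge> 0) \<and>
     (\<forall>U\<in>Dom H. quasiconvex (CS H U) (dC H U) (\<kappa> 0) (prset H U Y)) \<and>
     (\<forall>x R. R \<ge> 0 \<longrightarrow> (\<forall>U\<in>Dom H. dU H U {x} Y \<le> R) \<longrightarrow> infdist x Y \<le> \<kappa> R)"

definition is_gate :: "('d, 'x::metric_space, 'c, 'e) hstruct_scheme \<Rightarrow> 'x set \<Rightarrow> real \<Rightarrow> ('x \<Rightarrow> 'x) \<Rightarrow> bool" where
  "is_gate H Y C g \<longleftrightarrow>
     (\<forall>x. g x \<in> Y) \<and>
     (\<forall>x y. dist (g x) (g y) \<le> C * dist x y + C) \<and>
     (\<forall>y\<in>Y. dist (g y) y \<le> C) \<and>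
     (\<forall>W\<in>Dom H. \<forall>x. hausdorff_le (dC H W) (pr H W (g x)) (cpp (dC H W) (prset H W Y) (pr H W x)) C)"

definition fill_all_squares :: "('d, 'x::metric_space, 'c, 'e) hstruct_scheme \<Rightarrow> real \<Rightarrow> 'x set \<Rightarrow> 'x set \<Rightarrow> ('x \<Rightarrow> 'x) \<Rightarrow> ('x \<Rightarrow> 'x) \<Rightarrow> bool" where
  "fill_all_squares H T A B gA gB \<longleftrightarrow>
     (\<forall>U\<in>Dom H. \<forall>V\<in>Dom H. orth H U V \<longrightarrow>
        dense_in (dC H U) T (prset H U (gA ` B)) (prset H U A) \<or>
        dense_in (dC H V) T (prset H V (gB ` A)) (prset H V B))"

end

theory Submission
  imports Defs
begin

text \<open>Fix one point in every projection and every \<open>\<rho>\<^sup>V\<^sub>W\<close>, and compare points of the space by their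
  distances in all coordinates.

  If \<open>A \<union> B\<close> is hierarchically quasiconvex but \<open>a \<in> A\<close> and \<open>b \<in> B\<close> witness that the square \<open>U \<bottom> V\<close> is
  not filled, one builds a point \<open>x\<close> with the coordinates of \<open>a\<close> below \<open>U\<close>, those of \<open>b\<close> orthogonally
  to \<open>U\<close>, and \<open>\<rho>\<^sup>U\<^sub>W\<close> elsewhere. As \<open>A\<close> is large in \<open>U\<close>, each \<open>\<rho>\<^sup>U\<^sub>W\<close> is close to \<open>A\<close>, so \<open>x\<close> is close
  to \<open>A \<union> B\<close>, and the gate of a nearby point of \<open>A \<union> B\<close> contradicts the choice of \<open>a\<close> and \<open>b\<close>.
  The point \<open>x\<close> comes from a realisation theorem, proved by improving an orthogonal family of
  domains step by step; its potential is bounded in terms of the complexity.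

  Conversely, if a point is coordinatewise close to \<open>A \<union> B\<close>, it is coordinatewise close to \<open>A\<close> or
  coordinatewise close to \<open>B\<close>: a domain \<open>U\<close> where it is far from \<open>A\<close> and a domain \<open>V\<close> where it is
  far from \<open>B\<close> are incompatible in each of the possible relations between \<open>U\<close> and \<open>V\<close>.\<close>

section \<open>Hyperbolic geodesic spaces\<close>

locale hyperbolic_space =
  fixes M :: "'c set" and d :: "'c \<Rightarrow> 'c \<Rightarrow> real" and \<delta> :: real
  assumes metric: "metric_on M d"
    and geodesic: "geodesic_space M d"
    and hyp: "hyperbolic M d \<delta>"
begin

lemma nonneg: "x \<in> M \<Longrightarrow> y \<in> M \<Longrightarrow> 0 \<le> d x y"
  and refl: "x \<in> M \<Longrightarrow> d x x = 0"
  and sym: "x \<in> M \<Longrightarrow> y \<in> M \<Longrightarrow> d x y = d y x"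
  and triangle: "x \<in> M \<Longrightarrow> y \<in> M \<Longrightarrow> z \<in> M \<Longrightarrow> d x z \<le> d x y + d y z"
  using metric unfolding metric_on_def by blast+

lemma four_point:
  assumes "x \<in> M" "y \<in> M" "w \<in> M" "z \<in> M"
  shows "d x y + d w z \<le> max (d w y + d x z) (d w x + d y z) + 2 * \<delta>"
proof -
  have "gromov_prod d w x y \<ge> min (gromov_prod d w x z) (gromov_prod d w y z) - \<delta>"
    using hyp assms unfolding hyperbolic_def by blast
  then show ?thesis
    unfolding gromov_prod_def min_def max_def by (auto simp: field_simps split: if_splits)
qed

lemma delta_nonneg: "x \<in> M \<Longrightarrow> 0 \<le> \<delta>"
  using four_point[of x x x x] refl[of x] by simp

lemma geodesic_segD:
  assumes "geodesic_seg M d \<gamma> a b" "a \<in> M" "b \<in> M" "t \<in> {0..d a b}"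
  shows "\<gamma> t \<in> M" "d a (\<gamma> t) = t" "d (\<gamma> t) b = d a b - t"
proof -
  have g: "\<gamma> ` {0..d a b} \<subseteq> M" "\<gamma> 0 = a" "\<gamma> (d a b) = b"
    "\<And>s u. s \<in> {0..d a b} \<Longrightarrow> u \<in> {0..d a b} \<Longrightarrow> d (\<gamma> s) (\<gamma> u) = \<bar>s - u\<bar>"
    using assms(1) unfolding geodesic_seg_def by blast+
  show "\<gamma> t \<in> M" using g(1) assms(4) by blast
  show "d a (\<gamma> t) = t" using g(4)[of 0 t] g(2) assms(4) nonneg[OF assms(2,3)] by auto
  show "d (\<gamma> t) b = d a b - t" using g(4)[of t "d a b"] g(3) assms(4) by auto
qed

text \<open>Take the point of the geodesic at distance \<open>d m a\<close> from \<open>a\<close>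
  and apply the four-point inequality to it and \<open>a\<close>, \<open>b\<close>,
  \<open>m\<close>. If the geodesic is shorter than \<open>d m a\<close>, then
  \<open>d m b < c\<close> and the endpoint \<open>b\<close> serves.\<close>

lemma near_geodesic:
  assumes g: "geodesic_seg M d \<gamma> a b" and M: "a \<in> M" "b \<in> M" "m \<in> M"
    and c: "d m a + d m b \<le> d a b + c"
  shows "\<exists>t\<in>{0..d a b}. d m (\<gamma> t) \<le> c + 2 * \<delta>"
proof (cases "d m a \<le> d a b")
  case True
  define t where "t = d m a"
  have t: "t \<in> {0..d a b}" using True nonneg M by (auto simp: t_def)
  note s = geodesic_segD[OF g M(1,2) t]
  have "d a b + d m (\<gamma> t) \<le> max (d m b + d a (\<gamma> t)) (d m a + d b (\<gamma> t)) + 2 * \<delta>"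
    using four_point[OF M(1,2,3) s(1)] .
  then have "d m (\<gamma> t) \<le> c + 2 * \<delta>"
    using s c t sym[OF M(2) s(1)] triangle[OF M(1,3,2)] sym[OF M(1,3)]
    unfolding t_def max_def by (auto split: if_splits)
  then show ?thesis using t by blast
next
  case False
  have "d a b \<in> {0..d a b}" using nonneg M by simp
  moreover have "\<gamma> (d a b) = b" using g unfolding geodesic_seg_def by blast
  ultimately show ?thesis using False c delta_nonneg[OF M(1)] by (intro bexI[of _ "d a b"]) auto
qed

lemma near_quasiconvex:
  assumes qc: "quasiconvex M d k Y" and Y: "a \<in> Y" "b \<in> Y" and m: "m \<in> M"
    and c: "d m a + d m b \<le> d a b + c"
  shows "\<exists>y\<in>Y. d m y \<le> c + 2 * \<delta> + k"
proof -
  have YM: "Y \<subseteq> M" using qc unfolding quasiconvex_def by blast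
  then have ab: "a \<in> M" "b \<in> M" using Y by auto
  obtain \<gamma> where g: "geodesic_seg M d \<gamma> a b"
    using geodesic ab unfolding geodesic_space_def by blast
  obtain t where t: "t \<in> {0..d a b}" "d m (\<gamma> t) \<le> c + 2 * \<delta>"
    using near_geodesic[OF g ab m c] by blast
  obtain y where y: "y \<in> Y" "d (\<gamma> t) y \<le> k"
    using qc g Y t unfolding quasiconvex_def by blast
  have "d m y \<le> d m (\<gamma> t) + d (\<gamma> t) y"
    using triangle m geodesic_segD(1)[OF g ab t(1)] y YM by blast
  then show ?thesis using t y by force
qed

lemma quasiconvex_const_nonneg:
  assumes qc: "quasiconvex M d k Y" and a: "a \<in> Y"
  shows "0 \<le> k"
proof -
  have YM: "Y \<subseteq> M" using qc unfolding quasiconvex_def by blast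
  then have aM: "a \<in> M" using a by auto
  obtain \<gamma> where g: "geodesic_seg M d \<gamma> a a"
    using geodesic aM unfolding geodesic_space_def by blast
  have z: "0 \<in> {0..d a a}" using nonneg aM by simp
  then obtain y where y: "y \<in> Y" "d (\<gamma> 0) y \<le> k"
    using qc g a unfolding quasiconvex_def by blast
  have "0 \<le> d (\<gamma> 0) y" using nonneg geodesic_segD(1)[OF g aM aM z] y YM by blast
  then show ?thesis using y by simp
qed

text \<open>Only a point \<open>m\<close> on a geodesic from \<open>p\<close> in \<open>Y1\<close>
  to \<open>q\<close> in \<open>Y2\<close> needs work. By the four-point inequality \<open>m\<close>
  is nearly between \<open>p\<close> and \<open>y1\<close> or nearly between \<open>y1\<close> and
  \<open>q\<close>; in the second case \<open>y2\<close> replaces \<open>y1\<close> at cost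
  \<open>2 * D\<close>.\<close>

lemma quasiconvex_Un:
  assumes qc1: "quasiconvex M d k Y1" and qc2: "quasiconvex M d k Y2"
    and y: "y1 \<in> Y1" "y2 \<in> Y2" "d y1 y2 \<le> D"
  shows "quasiconvex M d (4 * \<delta> + 2 * D + k) (Y1 \<union> Y2)"
proof -
  have YM: "Y1 \<subseteq> M" "Y2 \<subseteq> M" using qc1 qc2 unfolding quasiconvex_def by blast+
  have yM: "y1 \<in> M" "y2 \<in> M" using y YM by auto
  note nn = delta_nonneg[OF yM(1)] nonneg[OF yM]
  have mixed: "\<exists>z\<in>Y1 \<union> Y2. d m z \<le> 4 * \<delta> + 2 * D + k"
    if p: "p \<in> Y1" and q: "q \<in> Y2" and m: "m \<in> M" and l: "d p m + d m q \<le> d p q" for p q m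
  proof -
    have M: "p \<in> M" "q \<in> M" using p q YM by auto
    have "d p q + d m y1 \<le> max (d m q + d p y1) (d m p + d q y1) + 2 * \<delta>"
      using four_point[OF M m yM(1)] .
    then consider "d p q + d m y1 \<le> d m q + d p y1 + 2 * \<delta>"
      | "d p q + d m y1 \<le> d m p + d q y1 + 2 * \<delta>"
      unfolding max_def by (auto split: if_splits)
    then show ?thesis
    proof cases
      case 1
      then have "d m p + d m y1 \<le> d p y1 + 2 * \<delta>" using l sym[OF m M(1)] by simp
      from near_quasiconvex[OF qc1 p y(1) m this] show ?thesis using nn y by force
    next
      case 2
      then have "d m q + d m y2 \<le> d q y2 + (2 * \<delta> + 2 * D)"
        using l sym[OF m M(1)] triangle[OF m yM] triangle[OF M(2) yM(2,1)] sym[OF yM] y by simp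
      from near_quasiconvex[OF qc2 q y(2) m this] show ?thesis using nn y by force
    qed
  qed
  show ?thesis
    unfolding quasiconvex_def
  proof (intro conjI ballI allI impI)
    show "Y1 \<union> Y2 \<subseteq> M" using YM by blast
    fix p q \<gamma> t
    assume p: "p \<in> Y1 \<union> Y2" and q: "q \<in> Y1 \<union> Y2" and g: "geodesic_seg M d \<gamma> p q"
      and t: "t \<in> {0..d p q}"
    have M: "p \<in> M" "q \<in> M" using p q YM by auto
    note s = geodesic_segD[OF g M t]
    have same: "\<exists>y\<in>Y. d (\<gamma> t) y \<le> 4 * \<delta> + 2 * D + k" if "quasiconvex M d k Y" "p \<in> Y" "q \<in> Y" for Y
    proof -
      have "\<exists>y\<in>Y. d (\<gamma> t) y \<le> k" using that g t unfolding quasiconvex_def by blast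
      then show ?thesis using nn y by force
    qed
    consider "p \<in> Y1" "q \<in> Y1" | "p \<in> Y2" "q \<in> Y2" | "p \<in> Y1" "q \<in> Y2" | "p \<in> Y2" "q \<in> Y1"
      using p q by blast
    then show "\<exists>y\<in>Y1 \<union> Y2. d (\<gamma> t) y \<le> 4 * \<delta> + 2 * D + k"
    proof cases
      case 1 then show ?thesis using same[OF qc1] by blast
    next
      case 2 then show ?thesis using same[OF qc2] by blast
    next
      case 3 then show ?thesis using mixed[OF _ _ s(1)] s by simp
    next
      case 4
      then show ?thesis
        using mixed[OF 4(2,1) s(1)] s sym[OF M] sym[OF M(1) s(1)] sym[OF M(2) s(1)] by simp
    qed
  qed
qed

text \<open>A reverse triangle inequality: a path from \<open>x\<close> to \<open>Y\<close> coarsely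
  passes through the closest point. Otherwise a point of the geodesic from \<open>y\<close> to
  \<open>y'\<close>, which is near \<open>Y\<close>, would be closer to \<open>x\<close> than
  \<open>y\<close> is.\<close>

lemma closest_point_ineq:
  assumes qc: "quasiconvex M d k Y" and x: "x \<in> M" and y: "y \<in> Y" "y' \<in> Y"
    and cl: "\<And>z. z \<in> Y \<Longrightarrow> d x y \<le> d x z + c"
  shows "d x y + d y y' \<le> d x y' + (2 * c + 2 * k + 4 * \<delta> + 1)"
proof -
  have YM: "Y \<subseteq> M" using qc unfolding quasiconvex_def by blast
  then have M: "y \<in> M" "y' \<in> M" using y by auto
  have nn: "0 \<le> k" "0 \<le> \<delta>" "0 \<le> c"
    using quasiconvex_const_nonneg[OF qc y(1)] delta_nonneg[OF x] cl[OF y(1)] by auto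
  \<comment> \<open>Just large enough to exclude the first alternative of the maximum in the
    four-point inequality below, which would give
    \<open>t \<le> c + k + 2 * \<delta>\<close>.\<close>
  define t where "t = c + k + 2 * \<delta> + 1"
  show ?thesis
  proof (cases "d y y' \<le> t")
    case True
    then show ?thesis using cl[OF y(2)] nn unfolding t_def by linarith
  next
    case False
    obtain \<gamma> where g: "geodesic_seg M d \<gamma> y y'"
      using geodesic M unfolding geodesic_space_def by blast
    have t: "t \<in> {0..d y y'}" using False nn unfolding t_def by auto
    note s = geodesic_segD[OF g M t]
    obtain z where z: "z \<in> Y" "d (\<gamma> t) z \<le> k"
      using qc g y t unfolding quasiconvex_def by blast
    have *: "d x y \<le> d x (\<gamma> t) + k + c"
      using cl[OF z(1)] triangle[OF x s(1), of z] z YM by auto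
    have "d y y' + d (\<gamma> t) x \<le> max (d (\<gamma> t) y' + d y x) (d (\<gamma> t) y + d y' x) + 2 * \<delta>"
      using four_point[OF M s(1) x] .
    then show ?thesis
      using s * sym[OF x s(1)] sym[OF x M(1)] sym[OF x M(2)] sym[OF M(1) s(1)]
      unfolding t_def max_def by (auto split: if_splits)
  qed
qed

text \<open>Add the previous inequality for \<open>x\<close> and for \<open>x'\<close>: the
  distances to the closest points cancel, and twice the claim remains.\<close>

lemma closest_point_lipschitz:
  assumes qc: "quasiconvex M d k Y" and x: "x \<in> M" "x' \<in> M" and y: "y \<in> Y" "y' \<in> Y"
    and cl: "\<And>z. z \<in> Y \<Longrightarrow> d x y \<le> d x z + c" "\<And>z. z \<in> Y \<Longrightarrow> d x' y' \<le> d x' z + c"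
  shows "d y y' \<le> d x x' + (2 * c + 2 * k + 4 * \<delta> + 1)"
proof -
  have M: "y \<in> M" "y' \<in> M" using qc y unfolding quasiconvex_def by auto
  show ?thesis
    using closest_point_ineq[OF qc x(1) y cl(1)] closest_point_ineq[OF qc x(2) y(2,1) cl(2)]
      triangle[OF x M(2)] triangle[OF x(2,1) M(1)] sym[OF x] sym[OF M]
    by linarith
qed

end

section \<open>Infimal distances between sets\<close>

lemma csetdist_le:
  assumes "metric_on M d" "P \<subseteq> M" "Q \<subseteq> M" "p \<in> P" "q \<in> Q"
  shows "csetdist d P Q \<le> d p q"
proof -
  have "bdd_below {d x y |x y. x \<in> P \<and> y \<in> Q}"
    using assms unfolding metric_on_def by (intro bdd_belowI[of _ 0]) blast
  then show ?thesis
    unfolding csetdist_def using assms by (auto intro!: cInf_lower)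
qed

lemma csetdist_lessE:
  assumes "P \<noteq> {}" "Q \<noteq> {}" "csetdist d P Q < r"
  obtains p q where "p \<in> P" "q \<in> Q" "d p q < r"
proof -
  have ne: "{d x y |x y. x \<in> P \<and> y \<in> Q} \<noteq> {}" using assms by blast
  show ?thesis
    using cInf_lessD[OF ne, of r] assms that unfolding csetdist_def by auto
qed

lemma dist_le_csetdist:
  assumes m: "metric_on M d" and PQ: "P \<subseteq> M" "Q \<subseteq> M" "p \<in> P" "q \<in> Q"
    and diam: "diam_le d P a" "diam_le d Q b"
  shows "d p q \<le> a + csetdist d P Q + b"
proof (rule field_le_epsilon)
  fix e :: real assume "0 < e"
  then obtain p' q' where p': "p' \<in> P" "q' \<in> Q" "d p' q' < csetdist d P Q + e"
    using csetdist_lessE[of P Q d "csetdist d P Q + e"] PQ by auto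
  have M: "p \<in> M" "q \<in> M" "p' \<in> M" "q' \<in> M" using PQ p' by auto
  have "d p q \<le> d p p' + d p' q" "d p' q \<le> d p' q' + d q' q"
    using m M unfolding metric_on_def by blast+
  moreover have "d p p' \<le> a" "d q' q \<le> b"
    using diam PQ p' unfolding diam_le_def by blast+
  ultimately show "d p q \<le> a + csetdist d P Q + b + e" using p' by linarith
qed

section \<open>Hierarchical structures with one chosen point in every projection\<close>

locale hier =
  fixes H :: "('d, 'x::metric_space, 'c) hstruct" and E :: real and \<theta> :: "real \<Rightarrow> real"
  assumes HHS: "HHS_with H E \<theta>"
begin

definition coord :: "'d \<Rightarrow> 'x \<Rightarrow> 'c" where
  "coord U x = (SOME p. p \<in> pr H U x)"

definition rel :: "'d \<Rightarrow> 'd \<Rightarrow> 'c" where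
  "rel V W = (SOME p. p \<in> rho H V W)"

text \<open>One constant for all errors of size \<open>E\<close>. The largest, \<open>6 * E\<close>,
  arises in \<open>large_links_near\<close>; the summand 1 gives \<open>1 \<le> K\<close>.\<close>

definition K :: real where "K = 6 * E + 1"

definition D :: "'d \<Rightarrow> 'x \<Rightarrow> 'x \<Rightarrow> real" where
  "D U x y = dC H U (coord U x) (coord U y)"

definition R :: "'d \<Rightarrow> 'x \<Rightarrow> 'd \<Rightarrow> real" where
  "R W x V = dC H W (coord W x) (rel V W)"

definition below :: "'d \<Rightarrow> 'd \<Rightarrow> bool" where
  "below V W \<longleftrightarrow> V \<in> Dom H \<and> W \<in> Dom H \<and> nest H V W \<and> V \<noteq> W"

definition trans :: "'d \<Rightarrow> 'd \<Rightarrow> bool" where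
  "trans V W \<longleftrightarrow> V \<in> Dom H \<and> W \<in> Dom H \<and> transverse H V W"

text \<open>The pairs for which the axioms make \<open>rho H V W\<close> a nonempty bounded subset
  of \<open>CS H W\<close>.\<close>

definition projects :: "'d \<Rightarrow> 'd \<Rightarrow> bool" where
  "projects V W \<longleftrightarrow> below V W \<or> trans V W"

text \<open>\<open>axioms_from_n\<close> is the conjunction from the n-th conjunct on, so its
  \<open>conjunct1\<close> is that conjunct. Conjuncts are counted singly, not by the numbers of the
  axioms.\<close>

lemmas axioms_from_1 = HHS[unfolded HHS_with_def]
lemmas axioms_from_2 = axioms_from_1[THEN conjunct2]
lemmas axioms_from_3 = axioms_from_2[THEN conjunct2]
lemmas axioms_from_4 = axioms_from_3[THEN conjunct2]
lemmas axioms_from_5 = axioms_from_4[THEN conjunct2]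
lemmas axioms_from_6 = axioms_from_5[THEN conjunct2]
lemmas axioms_from_7 = axioms_from_6[THEN conjunct2]
lemmas axioms_from_8 = axioms_from_7[THEN conjunct2]
lemmas axioms_from_9 = axioms_from_8[THEN conjunct2]
lemmas axioms_from_10 = axioms_from_9[THEN conjunct2]
lemmas axioms_from_11 = axioms_from_10[THEN conjunct2]
lemmas axioms_from_12 = axioms_from_11[THEN conjunct2]
lemmas axioms_from_13 = axioms_from_12[THEN conjunct2]
lemmas axioms_from_14 = axioms_from_13[THEN conjunct2]
lemmas axioms_from_15 = axioms_from_14[THEN conjunct2]
lemmas axioms_from_16 = axioms_from_15[THEN conjunct2]
lemmas axioms_from_17 = axioms_from_16[THEN conjunct2]
lemmas axioms_from_18 = axioms_from_17[THEN conjunct2]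
lemmas axioms_from_19 = axioms_from_18[THEN conjunct2]
lemmas axioms_from_20 = axioms_from_19[THEN conjunct2]
lemmas axioms_from_21 = axioms_from_20[THEN conjunct2]
lemmas axioms_from_22 = axioms_from_21[THEN conjunct2]
lemmas axioms_from_23 = axioms_from_22[THEN conjunct2]

lemma E_pos: "E > 0"
  using axioms_from_1[THEN conjunct1] .

lemma K_bounds: "1 \<le> K" "6 * E \<le> K" "E \<le> K" "0 < K"
  using E_pos unfolding K_def by auto

lemma space: "U \<in> Dom H \<Longrightarrow> hyperbolic_space (CS H U) (dC H U) E"
  using axioms_from_3[THEN conjunct1] unfolding hyperbolic_space_def by blast

lemma pr_props:
  assumes "U \<in> Dom H"
  shows "pr H U x \<noteq> {}" "pr H U x \<subseteq> CS H U" "diam_le (dC H U) (pr H U x) E"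
  using axioms_from_4[THEN conjunct1] assms by blast+

lemma metric: "U \<in> Dom H \<Longrightarrow> metric_on (CS H U) (dC H U)"
  using space unfolding hyperbolic_space_def by blast

lemma coord_pr: "U \<in> Dom H \<Longrightarrow> coord U x \<in> pr H U x"
  unfolding coord_def using pr_props(1) by (metis ex_in_conv someI_ex)

lemma coord_CS: "U \<in> Dom H \<Longrightarrow> coord U x \<in> CS H U"
  using coord_pr pr_props(2) by blast

lemma coord_near: "U \<in> Dom H \<Longrightarrow> p \<in> pr H U x \<Longrightarrow> dC H U p (coord U x) \<le> E"
  using coord_pr pr_props(3) unfolding diam_le_def by blast

lemma nest_refl: "U \<in> Dom H \<Longrightarrow> nest H U U"
  using axioms_from_7[THEN conjunct1] by blast

lemma nest_antisym: "U \<in> Dom H \<Longrightarrow> V \<in> Dom H \<Longrightarrow> nest H U V \<Longrightarrow> nest H V U \<Longrightarrow> U = V"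
  using axioms_from_8[THEN conjunct1] by blast

lemma nest_trans:
  assumes "U \<in> Dom H" "V \<in> Dom H" "W \<in> Dom H" "nest H U V" "nest H V W"
  shows "nest H U W"
  using axioms_from_9[THEN conjunct1] assms by blast

lemma ex1_maximal: "Dom H \<noteq> {} \<Longrightarrow> \<exists>!M. M \<in> Dom H \<and> (\<forall>U\<in>Dom H. nest H M U \<longrightarrow> U = M)"
  using axioms_from_10[THEN conjunct1] by (rule mp)

lemma orth_sym: "U \<in> Dom H \<Longrightarrow> V \<in> Dom H \<Longrightarrow> orth H U V \<Longrightarrow> orth H V U"
  using axioms_from_12[THEN conjunct1] by blast

lemma orth_irrefl: "U \<in> Dom H \<Longrightarrow> \<not> orth H U U"
  using axioms_from_13[THEN conjunct1] by blast

lemma orth_below: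
  assumes "U \<in> Dom H" "V \<in> Dom H" "W \<in> Dom H" "nest H V W" "orth H W U"
  shows "orth H V U"
  using axioms_from_14[THEN conjunct1] assms by blast

lemma orth_not_nest: "U \<in> Dom H \<Longrightarrow> V \<in> Dom H \<Longrightarrow> orth H U V \<Longrightarrow> \<not> nest H U V"
  using axioms_from_15[THEN conjunct1] by blast

lemma container:
  assumes "T \<in> Dom H" "U \<in> Dom H" "V \<in> Dom H" "nest H U T" "nest H V T" "orth H V U"
  obtains W where "below W T" "\<And>V. V \<in> Dom H \<Longrightarrow> orth H V U \<Longrightarrow> nest H V T \<Longrightarrow> nest H V W"
proof -
  note * = axioms_from_16[THEN conjunct1]
  have "\<exists>W\<in>Dom H. nest H W T \<and> W \<noteq> T \<and>
            (\<forall>V\<in>Dom H. orth H V U \<and> nest H V T \<longrightarrow> nest H V W)"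
    using *[rule_format, of T U] assms by blast
  then show ?thesis using that assms unfolding below_def by blast
qed

lemma finite_chain:
  assumes "C \<subseteq> Dom H" "\<And>U V. U \<in> C \<Longrightarrow> V \<in> C \<Longrightarrow> nest H U V \<or> nest H V U"
  shows "finite C" "real (card C) \<le> E"
proof -
  note * = axioms_from_20[THEN conjunct1]
  show "finite C" "real (card C) \<le> E"
    using *[rule_format, of C] assms by blast+
qed

lemma trans_sym: "trans V W \<Longrightarrow> trans W V"
  unfolding trans_def transverse_def using orth_sym by blast

lemma relation_cases:
  assumes "U \<in> Dom H" "V \<in> Dom H"
  obtains "U = V" | "below U V" | "below V U" | "orth H U V" | "trans U V"
  using assms that unfolding below_def trans_def transverse_def by blast

lemma rho_props:
  assumes "projects V W"
  shows "rho H V W \<noteq> {}" "rho H V W \<subseteq> CS H W" "diam_le (dC H W) (rho H V W) E"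
proof -
  note * = axioms_from_11[THEN conjunct1]
  note ** = axioms_from_17[THEN conjunct1]
  show "rho H V W \<noteq> {}" "rho H V W \<subseteq> CS H W" "diam_le (dC H W) (rho H V W) E"
    using assms * ** unfolding projects_def below_def trans_def by blast+
qed

lemma projects_Dom: "projects V W \<Longrightarrow> V \<in> Dom H" "projects V W \<Longrightarrow> W \<in> Dom H"
  unfolding projects_def below_def trans_def by blast+

lemma below_projects: "below V W \<Longrightarrow> projects V W"
  and trans_projects: "trans V W \<Longrightarrow> projects V W"
  unfolding projects_def by blast+

lemma rel_rho: "projects V W \<Longrightarrow> rel V W \<in> rho H V W"
  unfolding rel_def using rho_props(1) by (metis ex_in_conv someI_ex)

lemma rel_CS: "projects V W \<Longrightarrow> rel V W \<in> CS H W"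
  using rel_rho rho_props(2) by blast

lemma R_le:
  assumes "projects V W" "csetdist (dC H W) (pr H W x) (rho H V W) \<le> r"
  shows "R W x V \<le> r + 2 * E"
proof -
  have W: "W \<in> Dom H" using assms projects_Dom by blast
  show ?thesis
    using dist_le_csetdist[OF metric[OF W] pr_props(2)[OF W] rho_props(2)[OF assms(1)]
        coord_pr[OF W, of x] rel_rho[OF assms(1)] pr_props(3)[OF W] rho_props(3)[OF assms(1)]] assms(2)
    unfolding R_def by linarith
qed

lemma D_le_dU:
  assumes U: "U \<in> Dom H"
  shows "D U x y \<le> dU H U {x} {y} + 2 * E" and "dU H U {x} {y} \<le> D U x y"
proof -
  have s: "prset H U {x} = pr H U x" for x unfolding prset_def by simp
  show "D U x y \<le> dU H U {x} {y} + 2 * E"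
    using dist_le_csetdist[OF metric[OF U] pr_props(2)[OF U] pr_props(2)[OF U]
        coord_pr[OF U, of x] coord_pr[OF U, of y] pr_props(3)[OF U] pr_props(3)[OF U]]
    unfolding D_def dU_def s by linarith
  show "dU H U {x} {y} \<le> D U x y"
    unfolding D_def dU_def s
    by (rule csetdist_le[OF metric[OF U] pr_props(2)[OF U] pr_props(2)[OF U] coord_pr[OF U] coord_pr[OF U]])
qed

lemma D_nonneg: "U \<in> Dom H \<Longrightarrow> 0 \<le> D U x y"
  and D_refl: "U \<in> Dom H \<Longrightarrow> D U x x = 0"
  and D_sym: "U \<in> Dom H \<Longrightarrow> D U x y = D U y x"
  and D_triangle: "U \<in> Dom H \<Longrightarrow> D U x z \<le> D U x y + D U y z"
  unfolding D_def
  using hyperbolic_space.nonneg[OF space] hyperbolic_space.refl[OF space]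
    hyperbolic_space.sym[OF space] hyperbolic_space.triangle[OF space] coord_CS
  by blast+

lemma R_triangle: "projects V U \<Longrightarrow> R U x V \<le> D U x y + R U y V"
  and D_le_R: "projects V U \<Longrightarrow> D U x y \<le> R U x V + R U y V"
  and R_le_R3: "projects V U \<Longrightarrow> projects V' U \<Longrightarrow> R U x V' \<le> R U x V + R U y V + R U y V'"
proof -
  show "projects V U \<Longrightarrow> R U x V \<le> D U x y + R U y V"
    unfolding R_def D_def using hyperbolic_space.triangle[OF space] projects_Dom coord_CS rel_CS by metis
  show *: "projects V U \<Longrightarrow> D U x y \<le> R U x V + R U y V" for x y
    unfolding R_def D_def
    using hyperbolic_space.triangle[OF space] hyperbolic_space.sym[OF space] projects_Dom coord_CS rel_CS
    by metis
  show "projects V U \<Longrightarrow> projects V' U \<Longrightarrow> R U x V' \<le> R U x V + R U y V + R U y V'"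
  proof -
    assume a: "projects V U" "projects V' U"
    have "R U x V' \<le> D U x y + R U y V'"
      unfolding R_def D_def using hyperbolic_space.triangle[OF space] projects_Dom coord_CS rel_CS a by metis
    then show ?thesis using *[OF a(1), of x y] by linarith
  qed
qed

lemma D_lipschitz:
  assumes "U \<in> Dom H"
  shows "D U x y \<le> K * dist x y + K"
proof -
  have "diam_le (dC H U) (pr H U x \<union> pr H U y) (E * dist x y + E)"
    using axioms_from_5[THEN conjunct1] assms by blast
  then have "D U x y \<le> E * dist x y + E"
    unfolding diam_le_def D_def using coord_pr[OF assms] by blast
  moreover have "E * dist x y \<le> K * dist x y"
    using K_bounds by (intro mult_right_mono) auto
  ultimately show ?thesis using K_bounds by linarith
qed

lemma consistent:
  assumes "trans V W"
  shows "R W x V \<le> K \<or> R V x W \<le> K"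
proof -
  note * = axioms_from_17[THEN conjunct1]
  from * have "csetdist (dC H W) (pr H W x) (rho H V W) \<le> E \<or> csetdist (dC H V) (pr H V x) (rho H W V) \<le> E"
    using assms unfolding trans_def by (simp add: min_le_iff_disj)
  then show ?thesis
    using R_le[of V W x E] R_le[of W V x E] trans_projects assms trans_sym K_bounds E_pos by fastforce
qed

lemma projects_mono:
  assumes "U \<in> Dom H" "nest H U V" "projects V W" "\<not> orth H U W"
  shows "projects U W"
proof -
  have D: "V \<in> Dom H" "W \<in> Dom H" using assms projects_Dom by blast+
  show ?thesis
  proof (cases "below V W")
    case True
    then have "below U W"
      using assms D nest_trans[of U V W] nest_antisym[of V W] unfolding below_def by blast
    then show ?thesis by (rule below_projects)
  next
    case False
    then have "trans V W" using assms unfolding projects_def by blast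
    then have "\<not> nest H W U" "\<not> nest H W V"
      using assms D nest_trans[of W U V] unfolding trans_def transverse_def by blast+
    then show ?thesis using assms D nest_refl unfolding projects_def below_def trans_def transverse_def by blast
  qed
qed

lemma rel_close:
  assumes "U \<in> Dom H" "nest H U V" "projects V W" "\<not> orth H U W"
  shows "R W x U \<le> R W x V + K" "R W x V \<le> R W x U + K"
proof -
  have D: "V \<in> Dom H" "W \<in> Dom H" using assms projects_Dom by blast+
  note p = projects_mono[OF assms]
  note * = axioms_from_19[THEN conjunct1]
  have "(nest H V W \<and> V \<noteq> W) \<or> (transverse H V W \<and> \<not> orth H W U)"
    using assms D orth_sym unfolding projects_def below_def trans_def by blast
  then have "csetdist (dC H W) (rho H U W) (rho H V W) \<le> E" using * assms D by blast
  then have "dC H W (rel U W) (rel V W) \<le> K"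
    using dist_le_csetdist[OF metric[OF D(2)] rho_props(2)[OF p] rho_props(2)[OF assms(3)]
        rel_rho[OF p] rel_rho[OF assms(3)] rho_props(3)[OF p] rho_props(3)[OF assms(3)]] K_bounds E_pos
    by linarith
  moreover have "R W x V \<le> R W x U + dC H W (rel U W) (rel V W)"
    "R W x U \<le> R W x V + dC H W (rel V W) (rel U W)"
    "dC H W (rel V W) (rel U W) = dC H W (rel U W) (rel V W)"
    unfolding R_def
    using hyperbolic_space.triangle[OF space[OF D(2)] coord_CS[OF D(2)] rel_CS[OF p] rel_CS[OF assms(3)]]
      hyperbolic_space.triangle[OF space[OF D(2)] coord_CS[OF D(2)] rel_CS[OF assms(3)] rel_CS[OF p]]
      hyperbolic_space.sym[OF space[OF D(2)] rel_CS[OF assms(3)] rel_CS[OF p]]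
    by blast+
  ultimately show "R W x U \<le> R W x V + K" "R W x V \<le> R W x U + K" by linarith+
qed

lemma large_links:
  assumes W: "W \<in> Dom H"
  obtains Ts where "finite Ts" "\<And>T. T \<in> Ts \<Longrightarrow> below T W"
    "\<And>T. below T W \<Longrightarrow> K \<le> D T x y \<Longrightarrow> \<exists>T'\<in>Ts. nest H T T'"
    "\<And>T. T \<in> Ts \<Longrightarrow> R W x T \<le> E * D W x y + 3 * E"
proof -
  note * = axioms_from_21[THEN conjunct1]
  from *[THEN bspec, OF W, THEN spec, THEN spec, of x y]
  obtain Ts where Ts: "Ts \<subseteq> {T\<in>Dom H. nest H T W \<and> T \<noteq> W}" "finite Ts"
    and big: "\<forall>T\<in>Dom H. nest H T W \<and> T \<noteq> W \<longrightarrow> (\<exists>Ti\<in>Ts. nest H T Ti) \<or> dU H T {x} {y} < E"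
    and near: "\<forall>T\<in>Ts. csetdist (dC H W) (pr H W x) (rho H T W) \<le> E * dU H W {x} {y} + E"
    by (elim exE conjE) (rule that; assumption)
  have b: "below T W" if "T \<in> Ts" for T using Ts W that unfolding below_def by blast
  show ?thesis
  proof (rule that[of Ts])
    show "\<exists>T'\<in>Ts. nest H T T'" if "below T W" "K \<le> D T x y" for T
    proof -
      have "E \<le> dU H T {x} {y}"
        using D_le_dU(1)[of T x y] that K_bounds E_pos unfolding below_def by linarith
      then show ?thesis using big[THEN bspec, of T] that unfolding below_def by auto
    qed
    show "R W x T \<le> E * D W x y + 3 * E" if "T \<in> Ts" for T
      using R_le[OF below_projects[OF b[OF that]] near[THEN bspec, OF that]] E_pos
        mult_left_mono[OF D_le_dU(2)[OF W, of x y], of E] by linarith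
  qed (use Ts b in auto)
qed

text \<open>The nested counterpart of \<open>consistent\<close>. \<open>T\<close> is nested in a
  domain \<open>T'\<close> supplied by large links for \<open>x\<close> and \<open>y\<close>;
  \<open>rel T' W\<close> is near \<open>x\<close>, and \<open>rel T W\<close> is near
  \<open>rel T' W\<close>.\<close>

lemma large_links_near:
  assumes "below T W" "K \<le> D T x y"
  shows "R W x T \<le> K * D W x y + K"
proof -
  have W: "W \<in> Dom H" "T \<in> Dom H" using assms unfolding below_def by auto
  obtain Ts where Ts: "\<And>T. T \<in> Ts \<Longrightarrow> below T W"
    "\<And>T. below T W \<Longrightarrow> K \<le> D T x y \<Longrightarrow> \<exists>T'\<in>Ts. nest H T T'"
    "\<And>T. T \<in> Ts \<Longrightarrow> R W x T \<le> E * D W x y + 3 * E"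
    using large_links[OF W(1), of x y] by metis
  obtain T' where T': "T' \<in> Ts" "nest H T T'" using Ts(2) assms by blast
  have b: "below T' W" using Ts(1) T' by blast
  have "\<not> orth H T W" using orth_not_nest W assms unfolding below_def by blast
  then have "csetdist (dC H W) (rho H T W) (rho H T' W) \<le> E"
    using axioms_from_19[THEN conjunct1] W T' b unfolding below_def by blast
  note p = below_projects[OF assms(1)] and p' = below_projects[OF b]
  have "dC H W (rel T' W) (rel T W) \<le> 3 * E"
    using dist_le_csetdist[OF metric[OF W(1)] rho_props(2)[OF p] rho_props(2)[OF p']
        rel_rho[OF p] rel_rho[OF p'] rho_props(3)[OF p] rho_props(3)[OF p']]
      hyperbolic_space.sym[OF space[OF W(1)] rel_CS[OF p'] rel_CS[OF p]]
      \<open>csetdist (dC H W) (rho H T W) (rho H T' W) \<le> E\<close>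
    by linarith
  then have "R W x T \<le> R W x T' + 3 * E"
    unfolding R_def
    using hyperbolic_space.triangle[OF space[OF W(1)] coord_CS[OF W(1), of x] rel_CS[OF p'] rel_CS[OF p]]
    by linarith
  moreover have "E * D W x y \<le> K * D W x y"
    using K_bounds D_nonneg[OF W(1)] by (intro mult_right_mono) auto
  ultimately show ?thesis using Ts(3)[OF T'(1)] K_bounds E_pos by linarith
qed

definition orthogonal :: "'d set \<Rightarrow> bool" where
  "orthogonal F \<longleftrightarrow> finite F \<and> F \<subseteq> Dom H \<and> (\<forall>V\<in>F. \<forall>W\<in>F. V \<noteq> W \<longrightarrow> orth H V W)"

lemma orthogonal_single: "U \<in> Dom H \<Longrightarrow> orthogonal {U}"
  and orthogonal_pair: "U \<in> Dom H \<Longrightarrow> V \<in> Dom H \<Longrightarrow> orth H U V \<Longrightarrow> orthogonal {U, V}"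
  unfolding orthogonal_def using orth_sym by auto

text \<open>The prescribed coordinate in \<open>V\<close> is that of a point \<open>\<tau> V\<close>
  of the space, so it automatically lies in the image of the projection, as the axiom
  demands.\<close>

lemma partial_realisation:
  assumes "orthogonal F"
  obtains x where "\<And>V. V \<in> F \<Longrightarrow> D V x (\<tau> V) \<le> K"
    "\<And>V W. V \<in> F \<Longrightarrow> projects V W \<Longrightarrow> R W x V \<le> K"
proof -
  have F: "F \<subseteq> Dom H" "\<forall>V\<in>F. \<forall>W\<in>F. V \<noteq> W \<longrightarrow> orth H V W"
    using assms unfolding orthogonal_def by auto
  note * = axioms_from_23[THEN conjunct1]
  have "\<forall>V\<in>F. coord V (\<tau> V) \<in> prset H V UNIV"
    using coord_pr F unfolding prset_def by blast
  then have "\<exists>x. (\<forall>V\<in>F. csetdist (dC H V) (pr H V x) {coord V (\<tau> V)} \<le> E) \<and>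
      (\<forall>V\<in>F. \<forall>W\<in>Dom H. nest H V W \<and> V \<noteq> W \<longrightarrow> csetdist (dC H W) (pr H W x) (rho H V W) \<le> E) \<and>
      (\<forall>V\<in>F. \<forall>W\<in>Dom H. transverse H W V \<longrightarrow> csetdist (dC H W) (pr H W x) (rho H V W) \<le> E)"
    using F(2) by (intro *[THEN spec, THEN mp, OF F(1), THEN spec, THEN mp]) blast
  then obtain x where x: "\<forall>V\<in>F. csetdist (dC H V) (pr H V x) {coord V (\<tau> V)} \<le> E"
    "\<forall>V\<in>F. \<forall>W\<in>Dom H. nest H V W \<and> V \<noteq> W \<longrightarrow> csetdist (dC H W) (pr H W x) (rho H V W) \<le> E"
    "\<forall>V\<in>F. \<forall>W\<in>Dom H. transverse H W V \<longrightarrow> csetdist (dC H W) (pr H W x) (rho H V W) \<le> E"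
    by (elim exE conjE) (rule that; assumption)
  show ?thesis
  proof (rule that[of x])
    fix V assume V: "V \<in> F"
    then have VD: "V \<in> Dom H" using F by blast
    have "diam_le (dC H V) {coord V (\<tau> V)} 0"
      using D_refl[OF VD] unfolding diam_le_def D_def by simp
    then have "D V x (\<tau> V) \<le> E + E + 0"
      using dist_le_csetdist[OF metric[OF VD] pr_props(2)[OF VD, of x] _ coord_pr[OF VD], of "{coord V (\<tau> V)}" "coord V (\<tau> V)" E 0]
        pr_props(3)[OF VD, of x] coord_CS[OF VD] x(1)[THEN bspec, OF V] unfolding D_def by simp
    then show "D V x (\<tau> V) \<le> K" using K_bounds E_pos by linarith
    fix W assume p: "projects V W"
    have "csetdist (dC H W) (pr H W x) (rho H V W) \<le> E"
      using p x(2,3)[THEN bspec, OF V] trans_sym[of V W] unfolding projects_def below_def trans_def by blast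
    from R_le[OF p this] show "R W x V \<le> K" using K_bounds E_pos by linarith
  qed
qed

section \<open>Levels and orthogonal families\<close>

definition N :: nat where "N = nat \<lfloor>E\<rfloor>"

definition chains :: "'d \<Rightarrow> 'd set set" where
  "chains W = {C. C \<subseteq> Dom H \<and> (\<forall>U\<in>C. nest H U W) \<and> (\<forall>U\<in>C. \<forall>V\<in>C. nest H U V \<or> nest H V U)}"

text \<open>The height of \<open>W\<close> in the nesting order. Finite complexity bounds it by
  \<open>N\<close>, and it serves as the rank for inductions along nesting.\<close>

definition level :: "'d \<Rightarrow> nat" where
  "level W = Max (card ` chains W)"

lemma chains_card:
  assumes "C \<in> chains W"
  shows "finite C" "card C \<le> N"
proof -
  have C: "C \<subseteq> Dom H" "\<And>U V. U \<in> C \<Longrightarrow> V \<in> C \<Longrightarrow> nest H U V \<or> nest H V U"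
    using assms unfolding chains_def by auto
  show "finite C" by (rule finite_chain(1)[OF C])
  show "card C \<le> N" unfolding N_def by (rule le_nat_floor) (rule finite_chain(2)[OF C])
qed

lemma finite_card_chains: "finite (card ` chains W)" "card ` chains W \<noteq> {}"
proof -
  show "finite (card ` chains W)"
    by (rule finite_subset[of _ "{..N}"]) (use chains_card(2) in auto)
  have "{} \<in> chains W" unfolding chains_def by simp
  then show "card ` chains W \<noteq> {}" by blast
qed

lemma card_le_level: "C \<in> chains W \<Longrightarrow> card C \<le> level W"
  unfolding level_def by (rule Max_ge[OF finite_card_chains(1)]) simp

lemma level_witness: obtains C where "C \<in> chains W" "card C = level W"
proof -
  have "level W \<in> card ` chains W" unfolding level_def by (rule Max_in[OF finite_card_chains])
  then show ?thesis using that by auto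
qed

lemma level_le: "level W \<le> N"
proof -
  obtain C where "C \<in> chains W" "card C = level W" by (rule level_witness)
  then show ?thesis using chains_card(2)[of C W] by simp
qed

lemma level_pos: "W \<in> Dom H \<Longrightarrow> 1 \<le> level W"
  using card_le_level[of "{W}" W] nest_refl unfolding chains_def by auto

lemma level_strict: assumes "below V W" shows "level V < level W"
proof -
  obtain C where C: "C \<in> chains V" "card C = level V" by (rule level_witness)
  have *: "V \<in> Dom H" "W \<in> Dom H" "nest H V W" "V \<noteq> W" using assms unfolding below_def by auto
  have "nest H U W" if "U \<in> C" for U
    using C that * nest_trans[of U V W] unfolding chains_def by blast
  then have "insert W C \<in> chains W" using C * nest_refl unfolding chains_def by auto
  moreover have "W \<notin> C" using C * nest_antisym unfolding chains_def by blast
  ultimately show ?thesis using card_le_level chains_card(1)[OF C(1)] C(2) by fastforce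
qed

text \<open>The axiom gives only a unique maximal domain. Finite complexity puts it above every
  \<open>U\<close>: a domain of largest level among those above \<open>U\<close> is maximal, hence
  equal to it.\<close>

lemma maximum_exists:
  assumes "Dom H \<noteq> {}"
  obtains M where "M \<in> Dom H" "\<And>U. U \<in> Dom H \<Longrightarrow> nest H U M"
proof -
  obtain M where M: "M \<in> Dom H"
    and unique: "\<And>V. V \<in> Dom H \<Longrightarrow> (\<forall>U\<in>Dom H. nest H V U \<longrightarrow> U = V) \<Longrightarrow> V = M"
    using ex1_maximal[OF assms] by blast
  have "nest H U M" if U: "U \<in> Dom H" for U
  proof -
    define V where "V = arg_max level (\<lambda>V. V \<in> Dom H \<and> nest H U V)"
    have V: "(V \<in> Dom H \<and> nest H U V) \<and> (\<forall>V'. V' \<in> Dom H \<and> nest H U V' \<longrightarrow> level V' \<le> level V)"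
      unfolding V_def
      using U nest_refl level_le by (intro arg_max_nat_lemma[of _ U level "N + 1"]) (auto simp: less_Suc_eq_le)
    have "\<forall>W\<in>Dom H. nest H V W \<longrightarrow> W = V"
      using V level_strict[of V] nest_trans[of U V] U unfolding below_def by (metis leD)
    then show ?thesis using unique V by blast
  qed
  then show ?thesis using that M by blast
qed

text \<open>Remove one member \<open>U\<close>. The others lie in the container of the domains of
  \<open>T\<close> orthogonal to \<open>U\<close>, which is properly nested in \<open>T\<close> and
  so has smaller level.\<close>

lemma orthogonal_card_le_level:
  assumes "orthogonal F" "T \<in> Dom H" "\<And>U. U \<in> F \<Longrightarrow> nest H U T"
  shows "card F \<le> level T"
proof -
  have "finite F" using assms unfolding orthogonal_def by blast
  then show ?thesis using assms
  proof (induction F arbitrary: T)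
    case empty
    then show ?case by simp
  next
    case (insert U F)
    have o: "orthogonal F" and U: "U \<in> Dom H" "\<And>V. V \<in> F \<Longrightarrow> orth H V U \<and> V \<in> Dom H"
      using insert.prems(1) insert.hyps unfolding orthogonal_def by auto
    show ?case
    proof (cases "F = {}")
      case True
      then show ?thesis using level_pos insert.prems by simp
    next
      case False
      then obtain V where V: "V \<in> F" by blast
      obtain W where W: "below W T" "\<And>V. V \<in> Dom H \<Longrightarrow> orth H V U \<Longrightarrow> nest H V T \<Longrightarrow> nest H V W"
        using container[of T U V] U V insert.prems by blast
      have "card F \<le> level W"
        using insert.IH[OF o, of W] W U insert.prems unfolding below_def by blast
      then show ?thesis using level_strict[OF W(1)] insert.hyps by simp
    qed
  qed
qed

lemma orthogonal_card_le: "orthogonal F \<Longrightarrow> card F \<le> N"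
proof (cases "Dom H = {}")
  case False
  then obtain M where M: "M \<in> Dom H" "\<And>U. U \<in> Dom H \<Longrightarrow> nest H U M" by (rule maximum_exists) blast
  assume "orthogonal F"
  then show ?thesis
    using orthogonal_card_le_level[of F M] M level_le[of M] unfolding orthogonal_def by fastforce
qed (simp add: orthogonal_def)

text \<open>Induction on the level below the maximal domain: apart from \<open>W\<close> itself, the
  relevant domains nested in \<open>W\<close> lie under the finitely many domains given by large
  links.\<close>

lemma finite_relevant: "finite {T \<in> Dom H. K \<le> D T x y}"
proof (cases "Dom H = {}")
  case False
  have *: "finite {T \<in> Dom H. nest H T W \<and> K \<le> D T x y}" if "W \<in> Dom H" for W
    using that
  proof (induction "level W" arbitrary: W rule: less_induct)
    case less
    obtain Ts where Ts: "finite Ts" "\<And>T. T \<in> Ts \<Longrightarrow> below T W"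
      "\<And>T. below T W \<Longrightarrow> K \<le> D T x y \<Longrightarrow> \<exists>T'\<in>Ts. nest H T T'"
      using large_links[OF less.prems, of x y] by metis
    have "finite (\<Union>T'\<in>Ts. {T \<in> Dom H. nest H T T' \<and> K \<le> D T x y})"
      using Ts(1) less.hyps level_strict Ts(2) unfolding below_def by blast
    moreover have "{T \<in> Dom H. nest H T W \<and> K \<le> D T x y} \<subseteq>
        insert W (\<Union>T'\<in>Ts. {T \<in> Dom H. nest H T T' \<and> K \<le> D T x y})"
      using Ts(3) less.prems unfolding below_def by blast
    ultimately show ?case by (meson finite_insert finite_subset)
  qed
  obtain M where "M \<in> Dom H" "\<And>U. U \<in> Dom H \<Longrightarrow> nest H U M" using maximum_exists[OF False] by blast
  then have "{T \<in> Dom H. K \<le> D T x y} = {T \<in> Dom H. nest H T M \<and> K \<le> D T x y}" by blast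
  then show ?thesis using *[OF \<open>M \<in> Dom H\<close>] by simp
qed simp

section \<open>Realisation of consistent tuples\<close>

text \<open>A tuple of coordinates is given by a point \<open>\<tau> U\<close> of the space for each domain \<open>U\<close>, of which
  only the coordinate in \<open>U\<close> counts.\<close>

definition consistent_tuple :: "real \<Rightarrow> ('d \<Rightarrow> 'x) \<Rightarrow> bool" where
  "consistent_tuple c \<tau> \<longleftrightarrow>
     (\<forall>S T. trans S T \<longrightarrow> R S (\<tau> S) T \<le> c \<or> R T (\<tau> T) S \<le> c) \<and>
     (\<forall>S T x. below T S \<and> c \<le> D T x (\<tau> T) \<longrightarrow> R S (\<tau> S) T \<le> c * D S x (\<tau> S) + c) \<and>
     (\<forall>x. finite {T \<in> Dom H. c \<le> D T x (\<tau> T)})"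

definition spread :: "real \<Rightarrow> ('d \<Rightarrow> 'x) \<Rightarrow> 'd set \<Rightarrow> bool" where
  "spread r \<tau> F \<longleftrightarrow> (\<forall>W\<in>F. \<forall>S. projects W S \<longrightarrow> R S (\<tau> S) W \<le> r)"

text \<open>Every member contributes at least 1, and more the lower it lies. Adding a domain, or
  replacing one by a domain properly nested in it, therefore increases the sum.\<close>

definition potential :: "'d set \<Rightarrow> nat" where
  "potential F = (\<Sum>W\<in>F. N + 1 - level W)"

lemma potential_le: assumes "orthogonal F" shows "potential F \<le> N * (N + 1)"
proof -
  have "potential F \<le> of_nat (card F) * (N + 1)"
    unfolding potential_def by (rule sum_bounded_above) simp
  also have "\<dots> \<le> N * (N + 1)" using orthogonal_card_le[OF assms] by (simp del: mult_Suc_right)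
  finally show ?thesis .
qed

lemma finite_maximal:
  assumes "finite A" "A \<noteq> {}" "\<And>x. x \<in> A \<Longrightarrow> \<not> lt x x"
    "\<And>x y z. x \<in> A \<Longrightarrow> y \<in> A \<Longrightarrow> z \<in> A \<Longrightarrow> lt x y \<Longrightarrow> lt y z \<Longrightarrow> lt x z"
  shows "\<exists>m\<in>A. \<forall>x\<in>A. \<not> lt m x"
proof -
  have "asymp_on A lt" using assms(3,4) by (intro asymp_onI) blast
  moreover have "transp_on A lt" using assms(4) by (intro transp_onI) blast
  ultimately show ?thesis
    using Finite_Set.bex_max_element[OF assms(1) _ _ assms(2), of lt] assms(3) by metis
qed

text \<open>Among the domains in which \<open>x\<close> is far from the tuple there is one, \<open>T\<close>, whose relative
  projections lie close to the tuple: take \<open>T\<close> maximal for nesting, and among those last in the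
  order in which the domains are met on the way from the tuple to \<open>x\<close>.\<close>
lemma exists_last_bad_domain:
  assumes cons: "consistent_tuple c \<tau>" and c: "K \<le> c" and r: "4 * K + 3 * c \<le> r"
    and ex: "T0 \<in> Dom H" "r < D T0 x (\<tau> T0)"
  obtains T where "T \<in> Dom H" "r < D T x (\<tau> T)"
    "\<And>S. projects T S \<Longrightarrow> R S (\<tau> S) T \<le> c * r + c + r + K"
proof -
  define Bad where "Bad = {T \<in> Dom H. r < D T x (\<tau> T)}"
  define Mx where "Mx = {T \<in> Bad. \<forall>S\<in>Bad. \<not> below T S}"
  \<comment> \<open>\<open>lt S T\<close> places the tuple near \<open>rel T S\<close> in
    \<open>S\<close>. For bad \<open>S\<close> this forces \<open>x\<close> to be near
    \<open>rel S T\<close> in \<open>T\<close>, as \<open>x_near\<close> shows. A maximal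
    \<open>T\<close> has the tuple near \<open>rel T S\<close> for all transverse \<open>S\<close>
    in \<open>Mx\<close>.\<close>
  define lt where "lt S T \<longleftrightarrow> trans S T \<and> R S (\<tau> S) T \<le> c" for S T
  have K0: "0 < K" by (rule K_bounds)
  have c1: "R S (\<tau> S) T \<le> c \<or> R T (\<tau> T) S \<le> c" if "trans S T" for S T
    using cons that unfolding consistent_tuple_def by blast
  have c2: "R S (\<tau> S) T \<le> c * D S y (\<tau> S) + c" if "below T S" "c \<le> D T y (\<tau> T)" for S T y
    using cons that unfolding consistent_tuple_def by blast
  have BadD: "T \<in> Dom H" "r < D T x (\<tau> T)" if "T \<in> Bad" for T
    using that unfolding Bad_def by auto
  have fin: "finite Bad"
    using cons K0 c r unfolding consistent_tuple_def Bad_def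
    by (elim conjE allE[of _ x]) (rule finite_subset[rotated], assumption, auto)
  have above: "\<exists>S'\<in>Mx. nest H S S'" if "S \<in> Bad" for S
  proof -
    have "\<exists>m\<in>{S' \<in> Bad. nest H S S'}. \<forall>y\<in>{S' \<in> Bad. nest H S S'}. \<not> below m y"
    proof (rule finite_maximal)
      show "finite {S' \<in> Bad. nest H S S'}" using fin by simp
      show "{S' \<in> Bad. nest H S S'} \<noteq> {}" using that nest_refl BadD by blast
      show "below u w" if "below u v" "below v w" for u v w
        using that nest_trans[of u v w] nest_antisym[of u v] unfolding below_def by blast
    qed (simp add: below_def)
    then show ?thesis
      using BadD that nest_trans unfolding Mx_def below_def by blast
  qed
  have x_near: "R T x S \<le> K" if "lt S T" "S \<in> Bad" for S T
  proof -
    have p: "projects T S" "projects S T"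
      using that(1) trans_projects trans_sym unfolding lt_def by blast+
    have "K < R S x T"
      using D_le_R[OF p(1), of x "\<tau> S"] that BadD[of S] c r K0 unfolding lt_def by linarith
    then show ?thesis using consistent[of S T x] that unfolding lt_def by force
  qed
  have far: "c < R T (\<tau> T) S" if "lt S T" "S \<in> Bad" "T \<in> Bad" for S T
  proof -
    have "projects S T" using that(1) trans_projects unfolding lt_def by blast
    from D_le_R[OF this, of x "\<tau> T"] show ?thesis using x_near[OF that(1,2)] BadD[OF that(3)] c r K0 by linarith
  qed
  have cases_Mx: "S = T \<or> orth H S T \<or> trans S T" if "S \<in> Mx" "T \<in> Mx" for S T
    using relation_cases[of S T] that BadD unfolding Mx_def by blast
  have transitive: "lt S1 S3"
    if S: "S1 \<in> Mx" "S2 \<in> Mx" "S3 \<in> Mx" and l: "lt S1 S2" "lt S2 S3" for S1 S2 S3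
  proof -
    have B: "S1 \<in> Bad" "S2 \<in> Bad" "S3 \<in> Bad" using S unfolding Mx_def by auto
    have t: "trans S1 S2" "trans S2 S3" using l unfolding lt_def by auto
    note t' = t[THEN trans_sym]
    have p: "projects S1 S2" "projects S3 S2" "projects S2 S3"
      using t t' trans_projects by blast+
    have a: "R S2 x S1 \<le> K" "R S2 (\<tau> S2) S3 \<le> c" "R S3 x S2 \<le> K"
      using x_near l B unfolding lt_def by auto
    \<comment> \<open>In \<open>S2\<close>, the point \<open>rel S1 S2\<close> is near
      \<open>x\<close> and \<open>rel S3 S2\<close> is near the tuple; these are far apart because
      \<open>S2\<close> is bad.\<close>
    have sep: "2 * K < R S2 y S3" if "R S2 y S1 \<le> K" for y
    proof -
      have "D S2 x (\<tau> S2) \<le> D S2 x y + D S2 y (\<tau> S2)" using D_triangle BadD B by blast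
      moreover have "D S2 x y \<le> 2 * K" using D_le_R[OF p(1), of x y] a that by linarith
      moreover have "D S2 y (\<tau> S2) \<le> R S2 y S3 + c" using D_le_R[OF p(2), of y "\<tau> S2"] a by linarith
      ultimately show ?thesis using BadD(2)[OF B(2)] r c K0 by linarith
    qed
    have "S1 \<noteq> S3" using sep[of x] a K0 by auto
    \<comment> \<open>A point realising both \<open>S1\<close> and \<open>S3\<close> would be near
      both relative projections in \<open>S2\<close>, against \<open>sep\<close>.\<close>
    moreover have "\<not> orth H S1 S3"
    proof
      assume o: "orth H S1 S3"
      then have "orthogonal {S1, S3}" using orthogonal_pair BadD B by blast
      then obtain y where y: "\<And>V W. V \<in> {S1, S3} \<Longrightarrow> projects V W \<Longrightarrow> R W y V \<le> K"
        using partial_realisation by metis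
      have "R S2 y S1 \<le> K" "R S2 y S3 \<le> K" using y p by auto
      then show False using sep[of y] K0 by linarith
    qed
    ultimately have t13: "trans S1 S3" using cases_Mx S by blast
    show ?thesis
    proof (rule ccontr)
      assume "\<not> lt S1 S3"
      then have l31: "R S3 (\<tau> S3) S1 \<le> c" using c1[OF t13] t13 unfolding lt_def by blast
      have p13: "projects S1 S3" using t13 trans_projects by blast
      \<comment> \<open>By \<open>sep\<close> and consistency, \<open>z\<close> is near
        \<open>rel S2 S3\<close> in \<open>S3\<close>, hence near \<open>x\<close>. It is also near
        \<open>rel S1 S3\<close>, hence near the tuple. So \<open>S3\<close> would not be
        bad.\<close>
      obtain z where z: "\<And>W. projects S1 W \<Longrightarrow> R W z S1 \<le> K"
        using partial_realisation[OF orthogonal_single[OF BadD(1)[OF B(1)]]] by (metis singletonI)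
      have "K < R S2 z S3" using sep[of z] z[OF p(1)] K0 by linarith
      then have "R S3 z S2 \<le> K" using consistent[OF t(2), of z] by linarith
      then have "D S3 x z \<le> 2 * K" using D_le_R[OF p(3), of x z] a by linarith
      moreover have "D S3 z (\<tau> S3) \<le> K + c" using D_le_R[OF p13, of z "\<tau> S3"] z[OF p13] l31 by linarith
      ultimately have "D S3 x (\<tau> S3) \<le> 3 * K + c"
        using D_triangle[of S3 x "\<tau> S3" z] BadD B by force
      then show False using BadD(2)[OF B(3)] r c K0 by linarith
    qed
  qed
  have "\<exists>T\<in>Mx. \<forall>S\<in>Mx. \<not> lt T S"
  proof (rule finite_maximal)
    show "finite Mx" using fin unfolding Mx_def by simp
    show "Mx \<noteq> {}" using above[of T0] ex unfolding Bad_def by blast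
    show "\<not> lt S S" if "S \<in> Mx" for S
      using nest_refl BadD that unfolding lt_def trans_def transverse_def Mx_def by blast
  qed (use transitive in blast)
  then obtain T where T: "T \<in> Mx" "\<And>S. S \<in> Mx \<Longrightarrow> \<not> lt T S" by blast
  have TB: "T \<in> Bad" "\<And>S. S \<in> Bad \<Longrightarrow> \<not> below T S" using T unfolding Mx_def by auto
  note TD = BadD[OF TB(1)]
  have nn: "0 \<le> r" "0 \<le> c * r" using r c K0 by auto
  show ?thesis
  proof (rule that[OF TD])
    fix S assume p: "projects T S"
    then have SD: "S \<in> Dom H" using projects_Dom by blast
    consider "below T S" | "trans T S" using p unfolding projects_def by blast
    then show "R S (\<tau> S) T \<le> c * r + c + r + K"
    proof cases
      case 1
      \<comment> \<open>\<open>T\<close> is maximal among bad domains, so \<open>S\<close> is not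
        bad and the nested clause of consistency gives a bound.\<close>
      then have "D S x (\<tau> S) \<le> r" using TB(2) SD unfolding Bad_def by force
      then have "c * D S x (\<tau> S) \<le> c * r" using c K0 by (intro mult_left_mono) auto
      moreover have "c \<le> D T x (\<tau> T)" using TD r c K0 by linarith
      ultimately show ?thesis using c2[OF 1, of x] nn K0 by linarith
    next
      case 2
      note t = trans_sym[OF 2]
      have p': "projects S T" using t by (rule trans_projects)
      show ?thesis
      proof (cases "R S (\<tau> S) T \<le> c")
        case True
        then show ?thesis using nn K0 by linarith
      next
        case False
        then have near: "R T (\<tau> T) S \<le> c" using c1[OF t] by blast
        show ?thesis
        proof (cases "S \<in> Bad")
          case False
          then have small: "D S x (\<tau> S) \<le> r" using SD unfolding Bad_def by force
          \<comment> \<open>In the bad domain \<open>T\<close> the tuple is near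
            \<open>rel S T\<close>, so \<open>x\<close> is not. Consistency puts \<open>x\<close>
            near \<open>rel T S\<close> in \<open>S\<close>, where \<open>x\<close> is still close
            to the tuple.\<close>
          have "K < R T x S" using D_le_R[OF p', of x "\<tau> T"] near TD r c K0 by linarith
          then have "R S x T \<le> K" using consistent[OF t, of x] by linarith
          then have "R S (\<tau> S) T \<le> r + K"
            using R_triangle[OF p, of "\<tau> S" x] small D_sym[OF SD, of x "\<tau> S"] by linarith
          then show ?thesis using nn c K0 by linarith
        next
          case True
          \<comment> \<open>Pass to a maximal bad \<open>S'\<close> above \<open>S\<close>. Then
            \<open>lt S' T\<close>, so in \<open>T\<close> both \<open>x\<close> and the tuple are
            near \<open>rel S' T\<close>, and \<open>T\<close> would not be bad.\<close>
          then obtain S' where S': "S' \<in> Mx" "nest H S S'" using above by blast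
          have S'B: "S' \<in> Bad" using S' unfolding Mx_def by blast
          have S'D: "S' \<in> Dom H" using BadD S'B by blast
          have no: "\<not> orth H S T" "S' \<noteq> T" "\<not> orth H S' T"
            using t S' SD S'D TD orth_below[of T S S'] unfolding trans_def transverse_def by auto
          have tS': "trans S' T" using cases_Mx[OF S'(1) T(1)] no by blast
          have ptS': "projects S' T" using tS' by (rule trans_projects)
          have "lt S' T"
            using c1[OF tS'] T(2)[OF S'(1)] tS' trans_sym unfolding lt_def by blast
          then have "R T x S' \<le> K" using x_near S'B by blast
          moreover have "R T (\<tau> T) S' \<le> R T (\<tau> T) S + K"
            using rel_close(2)[OF SD S'(2) ptS' no(1)] by simp
          ultimately have "D T x (\<tau> T) \<le> 2 * K + c"
            using D_le_R[OF ptS', of x "\<tau> T"] near by linarith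
          then show ?thesis using TD r c K0 by linarith
        qed
      qed
    qed
  qed
qed

text \<open>Passing to \<open>F'\<close> either adds \<open>T\<close> or exchanges a single
  \<open>W\<close> above \<open>T\<close> for \<open>T\<close>, which has smaller level.\<close>

lemma extend_family:
  assumes F: "orthogonal F" and T: "T \<in> Dom H"
    and rel: "\<And>W. W \<in> F \<Longrightarrow> below T W \<or> orth H T W"
  defines "F' \<equiv> insert T {W \<in> F. orth H T W}"
  shows "orthogonal F'" "potential F < potential F'"
proof -
  define G where "G = {W \<in> F. orth H T W}"
  define B where "B = {W \<in> F. below T W}"
  have FD: "finite F" "F \<subseteq> Dom H" "\<And>V W. V \<in> F \<Longrightarrow> W \<in> F \<Longrightarrow> V \<noteq> W \<Longrightarrow> orth H V W"
    using F unfolding orthogonal_def by auto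
  show "orthogonal F'" unfolding orthogonal_def F'_def using FD T orth_sym by auto
  have disj: "\<not> orth H T W" if "below T W" for W
    using that orth_not_nest unfolding below_def by blast
  have FGB: "F = G \<union> B" "G \<inter> B = {}" using rel disj unfolding G_def B_def by auto
  have "T \<notin> G" using orth_irrefl T unfolding G_def by blast
  then have F': "potential F' = (N + 1 - level T) + potential G"
    using FD(1) unfolding potential_def F'_def G_def by simp
  have FG: "potential F = potential G + potential B"
    using FGB FD(1) sum.union_disjoint[of G B] unfolding potential_def by simp
  \<comment> \<open>Two different members of \<open>F\<close> are orthogonal, so a \<open>T\<close>
    nested in one is orthogonal to the other and cannot be nested in both.\<close>
  have "W = W'" if "W \<in> B" "W' \<in> B" for W W'
    using that FD disj orth_below[of W' T W] T unfolding B_def below_def by blast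
  then consider "B = {}" | W where "B = {W}" by blast
  then show "potential F < potential F'"
  proof cases
    case 1
    then show ?thesis using F' FG level_le[of T] unfolding potential_def by simp
  next
    case 2
    then have "below T W" unfolding B_def by blast
    then show ?thesis
      using F' FG 2 level_strict[of T W] level_le[of W] unfolding potential_def by simp
  qed
qed

text \<open>Induction on \<open>n\<close>, with \<open>r\<close> uniform in the tuple. Realise
  \<open>F\<close> with the coordinates of the tuple by \<open>x\<close>. If \<open>x\<close> misses
  the tuple somewhere, a well-chosen bad domain \<open>T\<close> is nested in or orthogonal to each
  member of \<open>F\<close>, and extending \<open>F\<close> by \<open>T\<close> raises the
  potential.\<close>

lemma realisation_step:
  assumes c: "K \<le> c"
  shows "\<exists>r\<ge>0. \<forall>\<tau>. consistent_tuple c \<tau> \<longrightarrow>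
    (\<exists>x. \<forall>T\<in>Dom H. D T x (\<tau> T) \<le> r) \<or> (\<exists>F. orthogonal F \<and> spread r \<tau> F \<and> n \<le> potential F)"
proof (induction n)
  case 0
  have "orthogonal {}" "spread 0 \<tau> {}" for \<tau> unfolding orthogonal_def spread_def by auto
  then show ?case by blast
next
  case (Suc n)
  then obtain r where r: "0 \<le> r" and IH: "\<And>\<tau>. consistent_tuple c \<tau> \<Longrightarrow>
    (\<exists>x. \<forall>T\<in>Dom H. D T x (\<tau> T) \<le> r) \<or> (\<exists>F. orthogonal F \<and> spread r \<tau> F \<and> n \<le> potential F)"
    by blast
  \<comment> \<open>\<open>r1\<close> exceeds \<open>r + K\<close>, which excludes
    \<open>projects W T\<close> for \<open>W\<close> in \<open>F\<close>, and meets the threshold of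
    \<open>exists_last_bad_domain\<close>; \<open>r2\<close> is the bound which that lemma
    returns.\<close>
  define r1 where "r1 = r + 4 * K + 3 * c"
  define r2 where "r2 = c * r1 + c + r1 + K"
  have K0: "0 < K" by (rule K_bounds)
  have r1: "0 \<le> r1" "r \<le> r1" "r + K \<le> r1" "4 * K + 3 * c \<le> r1" using r c K0 unfolding r1_def by auto
  have "0 \<le> c * r1" using r1 c K0 by auto
  then have r2: "r1 \<le> r2" "0 \<le> r2" using r1 c K0 unfolding r2_def by auto
  have "(\<exists>x. \<forall>T\<in>Dom H. D T x (\<tau> T) \<le> r2) \<or> (\<exists>F. orthogonal F \<and> spread r2 \<tau> F \<and> Suc n \<le> potential F)"
    if cons: "consistent_tuple c \<tau>" for \<tau>
    using IH[OF cons]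
  proof (elim disjE exE conjE)
    fix x assume "\<forall>T\<in>Dom H. D T x (\<tau> T) \<le> r"
    then show ?thesis using r1 r2 by (meson order_trans)
  next
    fix F assume F: "orthogonal F" "spread r \<tau> F" "n \<le> potential F"
    obtain x where x: "\<And>V. V \<in> F \<Longrightarrow> D V x (\<tau> V) \<le> K"
      "\<And>V W. V \<in> F \<Longrightarrow> projects V W \<Longrightarrow> R W x V \<le> K"
      using partial_realisation[OF F(1), of \<tau>] by metis
    show ?thesis
    proof (cases "\<forall>T\<in>Dom H. D T x (\<tau> T) \<le> r1")
      case True
      then show ?thesis using r2 by (meson order_trans)
    next
      case False
      then obtain T0 where "T0 \<in> Dom H" "r1 < D T0 x (\<tau> T0)" by force
      then obtain T where T: "T \<in> Dom H" "r1 < D T x (\<tau> T)"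
        "\<And>S. projects T S \<Longrightarrow> R S (\<tau> S) T \<le> r2"
        using exists_last_bad_domain[OF cons c r1(4)] unfolding r2_def by metis
      have rel: "below T W \<or> orth H T W" if W: "W \<in> F" for W
      proof -
        have "W \<in> Dom H" using F(1) W unfolding orthogonal_def by blast
        moreover have "T \<noteq> W" using x(1)[OF W] T(2) r1 r by auto
        \<comment> \<open>Otherwise \<open>x\<close>, by realisation, and the tuple, by
          \<open>spread\<close>, would both be near \<open>rel W T\<close>, so \<open>T\<close>
          would not be bad.\<close>
        moreover have "\<not> projects W T"
        proof
          assume p: "projects W T"
          have "R T (\<tau> T) W \<le> r" using F(2) W p unfolding spread_def by blast
          then show False using D_le_R[OF p, of x "\<tau> T"] x(2)[OF W p] T(2) r1 by linarith
        qed
        ultimately show ?thesis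
          using relation_cases[OF T(1), of W] trans_sym unfolding projects_def by metis
      qed
      define F' where "F' = insert T {W \<in> F. orth H T W}"
      have "orthogonal F'" "potential F < potential F'"
        using extend_family[OF F(1) T(1) rel] unfolding F'_def by auto
      moreover have "spread r2 \<tau> F'"
        using F(2) T(3) r1 r2 unfolding spread_def F'_def by fastforce
      ultimately show ?thesis using F(3) by (intro disjI2 exI[of _ F']) auto
    qed
  qed
  then show ?case using r2(2) by blast
qed

theorem realisation:
  assumes "K \<le> c"
  obtains r where "0 \<le> r" "\<And>\<tau>. consistent_tuple c \<tau> \<Longrightarrow> \<exists>x. \<forall>T\<in>Dom H. D T x (\<tau> T) \<le> r"
proof -
  \<comment> \<open>One step beyond the bound of \<open>potential_le\<close>, where the second
    alternative is impossible.\<close>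
  obtain r where "0 \<le> r" "\<And>\<tau>. consistent_tuple c \<tau> \<Longrightarrow> (\<exists>x. \<forall>T\<in>Dom H. D T x (\<tau> T) \<le> r) \<or>
      (\<exists>F. orthogonal F \<and> spread r \<tau> F \<and> Suc (N * (N + 1)) \<le> potential F)"
    using realisation_step[OF assms, of "Suc (N * (N + 1))"] by blast
  then show ?thesis using that potential_le by (meson not_less_eq_eq)
qed

section \<open>Gluing two points along a domain\<close>

lemma projects_not_orth: "projects V W \<Longrightarrow> \<not> orth H V W"
  unfolding projects_def below_def trans_def transverse_def using orth_not_nest by blast

lemma projectsI:
  assumes "U \<in> Dom H" "W \<in> Dom H" "\<not> nest H W U" "\<not> orth H W U"
  shows "projects U W"
  using relation_cases[of U W] assms nest_refl orth_sym unfolding projects_def below_def by metis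

text \<open>The coordinates of \<open>a\<close> below \<open>U\<close>, of \<open>b\<close> orthogonally to \<open>U\<close>, and of a point realising
  \<open>U\<close> elsewhere form a consistent tuple.\<close>
lemma glue:
  obtains r where "0 \<le> r" "\<And>U a b. U \<in> Dom H \<Longrightarrow>
    \<exists>x. (\<forall>W\<in>Dom H. nest H W U \<longrightarrow> D W x a \<le> r) \<and> (\<forall>W\<in>Dom H. orth H W U \<longrightarrow> D W x b \<le> r) \<and>
        (\<forall>W. projects U W \<longrightarrow> R W x U \<le> r)"
proof -
  have K: "1 \<le> K" "K \<le> 3 * K" using K_bounds by auto
  obtain r0 where r0: "0 \<le> r0" "\<And>\<tau>. consistent_tuple (3 * K) \<tau> \<Longrightarrow> \<exists>x. \<forall>T\<in>Dom H. D T x (\<tau> T) \<le> r0"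
    using realisation[OF K(2)] by metis
  have "\<exists>x. (\<forall>W\<in>Dom H. nest H W U \<longrightarrow> D W x a \<le> r0 + K) \<and> (\<forall>W\<in>Dom H. orth H W U \<longrightarrow> D W x b \<le> r0 + K) \<and>
        (\<forall>W. projects U W \<longrightarrow> R W x U \<le> r0 + K)" if U: "U \<in> Dom H" for U a b
  proof -
    obtain z where z: "\<And>W. projects U W \<Longrightarrow> R W z U \<le> K"
      using partial_realisation[OF orthogonal_single[OF U]] by (metis singletonI)
    define \<tau> where "\<tau> W = (if nest H W U then a else if orth H W U then b else z)" for W
    \<comment> \<open>\<open>rel S T\<close> is close to \<open>rel U T\<close>: for nested
      \<open>S\<close> by consistency of relative projections, for orthogonal \<open>S\<close>
      through a point realising both \<open>S\<close> and \<open>U\<close>. The latter adds three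
      errors \<open>K\<close>.\<close>
    have near: "R T (\<tau> T) S \<le> 3 * K"
      if p: "projects S T" and S: "nest H S U \<or> orth H S U" and T: "\<not> nest H T U" "\<not> orth H T U" for S T
    proof -
      have D: "S \<in> Dom H" "T \<in> Dom H" using projects_Dom p by blast+
      have pU: "projects U T" using projectsI U D T by blast
      have "R T z S \<le> 3 * K"
        using S
      proof
        assume "nest H S U"
        then show ?thesis
          using rel_close(1)[OF D(1) _ pU projects_not_orth[OF p], of z] z[OF pU] K by linarith
      next
        assume "orth H S U"
        then have "orthogonal {S, U}" using orthogonal_pair D U by blast
        then obtain y where y: "\<And>V W. V \<in> {S, U} \<Longrightarrow> projects V W \<Longrightarrow> R W y V \<le> K"
          using partial_realisation by metis
        then have "R T y S \<le> K" "R T y U \<le> K" using p pU by auto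
        then show ?thesis using R_le_R3[OF pU p, of z y] z[OF pU] by linarith
      qed
      then show ?thesis using T unfolding \<tau>_def by simp
    qed
    have "consistent_tuple (3 * K) \<tau>"
      unfolding consistent_tuple_def
    proof (intro conjI allI impI)
      fix S T assume t: "trans S T"
      have p: "projects S T" "projects T S" using t trans_sym trans_projects by blast+
      have D: "S \<in> Dom H" "T \<in> Dom H" using projects_Dom p by blast+
      have "\<not> orth H S T" "\<not> orth H T S" using projects_not_orth p by blast+
      \<comment> \<open>So if the tuple uses different points in \<open>S\<close> and
        \<open>T\<close>, exactly one of the two domains is neither nested in nor orthogonal to
        \<open>U\<close>, and \<open>near\<close> applies there.\<close>
      then have no: "\<not> (nest H S U \<and> orth H T U)" "\<not> (nest H T U \<and> orth H S U)"
        using orth_below[OF D(2,1) U] orth_below[OF D U] orth_sym D U by blast+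
      show "R S (\<tau> S) T \<le> 3 * K \<or> R T (\<tau> T) S \<le> 3 * K"
      proof (cases "\<tau> S = \<tau> T")
        case True
        then show ?thesis using consistent[OF t, of "\<tau> S"] K by auto
      next
        case False
        then show ?thesis using no near p unfolding \<tau>_def by (auto split: if_splits)
      qed
    next
      fix S T x assume a: "below T S \<and> 3 * K \<le> D T x (\<tau> T)"
      then have b: "below T S" and D: "S \<in> Dom H" "T \<in> Dom H" "nest H T S"
        unfolding below_def by auto
      note p = below_projects[OF b]
      have nn: "0 \<le> K * D S x (\<tau> S)" using K D_nonneg[OF D(1)] by simp
      have down: "nest H S U \<Longrightarrow> nest H T U" "orth H S U \<Longrightarrow> orth H T U"
        using nest_trans[of T S U] orth_below[of U T S] D U by blast+
      show "R S (\<tau> S) T \<le> 3 * K * D S x (\<tau> S) + 3 * K"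
      proof (cases "\<tau> S = \<tau> T")
        case True
        have "K \<le> D T (\<tau> S) x" using a True K D_sym[OF D(2), of x "\<tau> S"] by simp
        from large_links_near[OF b this] show ?thesis
          using D_sym[OF D(1), of x "\<tau> S"] nn K by simp
      next
        case False
        \<comment> \<open>Nestedness in \<open>U\<close> and orthogonality to \<open>U\<close> pass
          from \<open>S\<close> down to \<open>T\<close>; different points thus mean that
          \<open>T\<close> has one of these properties and \<open>S\<close> neither.\<close>
        then have "R S (\<tau> S) T \<le> 3 * K"
          using down orth_not_nest[of S U] orth_not_nest[of T U] near[OF p] D U unfolding \<tau>_def
          by (auto split: if_splits)
        then show ?thesis using nn by linarith
      qed
    next
      fix x
      have "{T \<in> Dom H. 3 * K \<le> D T x (\<tau> T)} \<subseteq>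
          {T \<in> Dom H. K \<le> D T x a} \<union> {T \<in> Dom H. K \<le> D T x b} \<union> {T \<in> Dom H. K \<le> D T x z}"
        using K unfolding \<tau>_def by (auto split: if_splits)
      then show "finite {T \<in> Dom H. 3 * K \<le> D T x (\<tau> T)}"
        by (rule finite_subset) (simp add: finite_relevant)
    qed
    then obtain x where x: "\<And>T. T \<in> Dom H \<Longrightarrow> D T x (\<tau> T) \<le> r0" using r0 by blast
    have "D W x a \<le> r0 + K" if "W \<in> Dom H" "nest H W U" for W
      using x[of W] that K unfolding \<tau>_def by simp
    moreover have "D W x b \<le> r0 + K" if "W \<in> Dom H" "orth H W U" for W
      using x[of W] that K orth_not_nest[of W U] U unfolding \<tau>_def by simp
    moreover have "R W x U \<le> r0 + K" if p: "projects U W" for W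
    proof -
      have W: "W \<in> Dom H" using projects_Dom p by blast
      have "\<not> nest H W U" "\<not> orth H W U"
        using p projects_not_orth[OF p] orth_sym U W nest_antisym[of U W]
        unfolding projects_def below_def trans_def transverse_def by blast+
      then have "D W x z \<le> r0" using x[OF W] unfolding \<tau>_def by simp
      then show ?thesis using R_triangle[OF p, of x z] z[OF p] by linarith
    qed
    ultimately show ?thesis by blast
  qed
  then show ?thesis using that[of "r0 + K"] r0(1) K by force
qed

section \<open>Gated subsets\<close>

definition gated :: "real \<Rightarrow> real \<Rightarrow> 'x set \<Rightarrow> ('x \<Rightarrow> 'x) \<Rightarrow> bool" where
  "gated k c A g \<longleftrightarrow> (\<forall>x. g x \<in> A) \<and>
     (\<forall>U\<in>Dom H. quasiconvex (CS H U) (dC H U) k (coord U ` A)) \<and>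
     (\<forall>U\<in>Dom H. \<forall>x. \<forall>a\<in>A. D U x (g x) \<le> D U x a + c)"

lemma gatedD:
  assumes "gated k c A g"
  shows "g x \<in> A" "U \<in> Dom H \<Longrightarrow> quasiconvex (CS H U) (dC H U) k (coord U ` A)"
    "U \<in> Dom H \<Longrightarrow> a \<in> A \<Longrightarrow> D U x (g x) \<le> D U x a + c"
    "U \<in> Dom H \<Longrightarrow> 0 \<le> c" "U \<in> Dom H \<Longrightarrow> 0 \<le> k"
proof -
  show 1: "g x \<in> A" for x using assms unfolding gated_def by blast
  show 2: "U \<in> Dom H \<Longrightarrow> quasiconvex (CS H U) (dC H U) k (coord U ` A)"
    using assms unfolding gated_def by blast
  show 3: "U \<in> Dom H \<Longrightarrow> a \<in> A \<Longrightarrow> D U x (g x) \<le> D U x a + c" for a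
    using assms unfolding gated_def by blast
  show "U \<in> Dom H \<Longrightarrow> 0 \<le> c" using 3[OF _ 1[of x]] by simp
  show "0 \<le> k" if U: "U \<in> Dom H"
    using hyperbolic_space.quasiconvex_const_nonneg[OF space[OF U] 2[OF U] imageI[OF 1]] .
qed

definition gate_const :: "real \<Rightarrow> real \<Rightarrow> real" where
  "gate_const k c = 2 * c + 2 * k + 4 * E + 1"

lemma gate_ineq:
  assumes g: "gated k c A g" and U: "U \<in> Dom H" and a: "a \<in> A"
  shows "D U x (g x) + D U (g x) a \<le> D U x a + gate_const k c"
  unfolding D_def gate_const_def
  by (rule hyperbolic_space.closest_point_ineq[OF space[OF U] gatedD(2)[OF g U] coord_CS[OF U]])
    (use gatedD(1)[OF g] gatedD(3)[OF g U] a in \<open>auto simp: D_def\<close>)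

lemma gate_lipschitz:
  assumes g: "gated k c A g" and U: "U \<in> Dom H"
  shows "D U (g x) (g y) \<le> D U x y + gate_const k c"
  unfolding D_def gate_const_def
  by (rule hyperbolic_space.closest_point_lipschitz[OF space[OF U] gatedD(2)[OF g U] coord_CS[OF U] coord_CS[OF U]])
    (use gatedD(1)[OF g] gatedD(3)[OF g U] in \<open>auto simp: D_def\<close>)

text \<open>In \<open>gated_near_rel\<close> each gate costs \<open>2 * K + c\<close>; the remaining
  \<open>K\<close> keeps the two gates far enough apart for large links.\<close>

definition diam_const :: "real \<Rightarrow> real" where
  "diam_const c = 5 * K + 2 * c"

definition rel_const :: "real \<Rightarrow> real \<Rightarrow> real" where
  "rel_const k c = K * (2 * K + gate_const k c) + K"

text \<open>For \<open>U\<close> nested in \<open>W\<close>, the points realising \<open>a\<close> and \<open>a'\<close> in \<open>U\<close> have close gates in \<open>W\<close> and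
  distant gates in \<open>U\<close>, so large links applies to the gates.\<close>
lemma gated_near_rel:
  assumes g: "gated k c A g" and a: "a \<in> A" "a' \<in> A" and d: "diam_const c < D U a a'" and p: "projects U W"
  shows "\<exists>a''\<in>A. R W a'' U \<le> rel_const k c"
proof -
  have Dm: "U \<in> Dom H" "W \<in> Dom H" using projects_Dom p by blast+
  note cn = gatedD(4)[OF g Dm(1)] gatedD(5)[OF g Dm(1)]
  have L0: "0 \<le> gate_const k c" using cn E_pos unfolding gate_const_def by simp
  have K: "1 \<le> K" by (rule K_bounds)
  then have "0 \<le> K * (2 * K + gate_const k c)" using L0 by simp
  then have KQ: "K \<le> rel_const k c" unfolding rel_const_def by simp
  consider "below U W" | "trans U W" using p unfolding projects_def by blast
  then show ?thesis
  proof cases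
    case 1
    obtain x where x: "D U x a \<le> K" "R W x U \<le> K"
      using partial_realisation[OF orthogonal_single[OF Dm(1)], of "\<lambda>_. a"] p by (metis singletonI)
    obtain y where y: "D U y a' \<le> K" "R W y U \<le> K"
      using partial_realisation[OF orthogonal_single[OF Dm(1)], of "\<lambda>_. a'"] p by (metis singletonI)
    have "D W x y \<le> 2 * K" using D_le_R[OF p, of x y] x y by linarith
    then have W: "D W (g x) (g y) \<le> 2 * K + gate_const k c" using gate_lipschitz[OF g Dm(2), of x y] by linarith
    have "D U (g x) a \<le> 2 * K + c"
      using gatedD(3)[OF g Dm(1) a(1), of x] x D_triangle[OF Dm(1), of "g x" a x] D_sym[OF Dm(1), of x "g x"]
      by linarith
    moreover have "D U (g y) a' \<le> 2 * K + c"
      using gatedD(3)[OF g Dm(1) a(2), of y] y D_triangle[OF Dm(1), of "g y" a' y] D_sym[OF Dm(1), of y "g y"]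
      by linarith
    ultimately have "K \<le> D U (g x) (g y)"
      using d D_triangle[OF Dm(1), of a a' "g x"] D_triangle[OF Dm(1), of "g x" a' "g y"]
        D_sym[OF Dm(1), of a "g x"] unfolding diam_const_def by linarith
    from large_links_near[OF 1 this] have "R W (g x) U \<le> K * D W (g x) (g y) + K" .
    also have "\<dots> \<le> rel_const k c" unfolding rel_const_def using W K by simp
    finally show ?thesis using gatedD(1)[OF g] by blast
  next
    case 2
    have p': "projects W U" using trans_projects[OF trans_sym[OF 2]] .
    \<comment> \<open>Two points so far apart in \<open>U\<close> cannot both be near
      \<open>rel W U\<close>; by consistency the other one is near \<open>rel U W\<close>.\<close>
    have "\<not> (R U a W \<le> K \<and> R U a' W \<le> K)"
      using D_le_R[OF p', of a a'] d K cn unfolding diam_const_def by linarith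
    then show ?thesis using consistent[OF 2, of a] consistent[OF 2, of a'] a KQ by (meson order_trans)
  qed
qed

text \<open>As \<open>a0\<close> is near \<open>b0\<close>, the gate inequality places
  \<open>g b\<close> nearly between the points \<open>b\<close> and \<open>b0\<close> of
  \<open>B\<close> in \<open>U\<close>; quasiconvexity of \<open>B\<close> finishes.\<close>

lemma gate_near_other:
  assumes g: "gated k c A g" and g': "gated k c B g'" and U: "U \<in> Dom H"
    and ab: "a0 \<in> A" "b0 \<in> B" "D U a0 b0 \<le> d" and b: "b \<in> B"
  shows "\<exists>b'\<in>B. D U (g b) b' \<le> gate_const k c + 2 * d + 2 * E + k"
proof -
  have "D U (g b) b + D U (g b) b0 \<le> D U b b0 + (gate_const k c + 2 * d)"
    using gate_ineq[OF g U ab(1), of b] D_sym[OF U, of b "g b"] ab(3)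
      D_triangle[OF U, of "g b" b0 a0] D_triangle[OF U, of b a0 b0] D_sym[OF U, of b0 a0] by linarith
  then have "\<exists>y\<in>coord U ` B. dC H U (coord U (g b)) y \<le> gate_const k c + 2 * d + 2 * E + k"
    unfolding D_def
    by (intro hyperbolic_space.near_quasiconvex[OF space[OF U] gatedD(2)[OF g' U] _ _ coord_CS[OF U]])
      (use b ab in auto)
  then show ?thesis unfolding D_def by blast
qed

section \<open>Filling squares\<close>

definition fills :: "real \<Rightarrow> 'x set \<Rightarrow> 'x set \<Rightarrow> ('x \<Rightarrow> 'x) \<Rightarrow> ('x \<Rightarrow> 'x) \<Rightarrow> bool" where
  "fills T A B gA gB \<longleftrightarrow> (\<forall>U\<in>Dom H. \<forall>V\<in>Dom H. orth H U V \<longrightarrow>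
     (\<forall>a\<in>A. \<exists>b\<in>B. D U (gA b) a \<le> T) \<or> (\<forall>b\<in>B. \<exists>a\<in>A. D V (gB a) b \<le> T))"

lemma infdist_leE:
  assumes "infdist x Y \<le> r" "Y \<noteq> {}"
  obtains y where "y \<in> Y" "dist x y < r + 1"
proof -
  have "(INF y\<in>Y. dist x y) < r + 1" using assms by (simp add: infdist_notempty)
  then show ?thesis using that cInf_lessD[of "dist x ` Y"] assms(2) by auto
qed

text \<open>If \<open>a\<close> and \<open>b\<close> witness the failure of filling for \<open>U \<bottom> V\<close>, the point glued from \<open>a\<close> in \<open>U\<close> and \<open>b\<close>
  orthogonally to \<open>U\<close> is close to \<open>A \<union> B\<close> in every coordinate, hence close to some \<open>y \<in> A \<union> B\<close>. But
  \<open>y \<in> B\<close> has its gate in \<open>A\<close> close to \<open>a\<close> in \<open>U\<close>, and \<open>y \<in> A\<close> has its gate in \<open>B\<close> close to \<open>b\<close> in \<open>V\<close>.\<close>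
lemma union_imp_fills:
  fixes \<kappa> :: "real \<Rightarrow> real"
  shows "\<exists>T\<ge>0. \<forall>A B gA gB. gated k c A gA \<and> gated k c B gB \<and>
    (\<forall>x r. 0 \<le> r \<longrightarrow> (\<forall>U\<in>Dom H. \<exists>y\<in>A \<union> B. D U x y \<le> r) \<longrightarrow> infdist x (A \<union> B) \<le> \<kappa> r) \<longrightarrow>
    fills T A B gA gB"
proof -
  obtain r where r: "0 \<le> r" and glued: "\<And>U a b. U \<in> Dom H \<Longrightarrow>
    \<exists>x. (\<forall>W\<in>Dom H. nest H W U \<longrightarrow> D W x a \<le> r) \<and> (\<forall>W\<in>Dom H. orth H W U \<longrightarrow> D W x b \<le> r) \<and>
        (\<forall>W. projects U W \<longrightarrow> R W x U \<le> r)"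
    using glue by metis
  \<comment> \<open>\<open>r0\<close> bounds the coordinate distances from the glued point
    \<open>x\<close> to the union, \<open>J\<close> those from \<open>x\<close> to a nearby point
    \<open>y\<close> of the union.\<close>
  define r0 where "r0 = r + \<bar>rel_const k c\<bar>"
  define J where "J = K * (\<bar>\<kappa> r0\<bar> + 1) + K"
  define T where "T = 2 * (J + r) + \<bar>c\<bar> + \<bar>diam_const c\<bar>"
  have K: "1 \<le> K" by (rule K_bounds)
  have "0 \<le> K * (\<bar>\<kappa> r0\<bar> + 1)" using K by simp
  then have J: "0 \<le> J" unfolding J_def using K by linarith
  have T: "0 \<le> T" "diam_const c \<le> T" "2 * (J + r) + c \<le> T" unfolding T_def using J r by auto
  have "fills T A B gA gB"
    if gA: "gated k c A gA" and gB: "gated k c B gB" and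
      near: "\<And>x r. 0 \<le> r \<Longrightarrow> (\<forall>U\<in>Dom H. \<exists>y\<in>A \<union> B. D U x y \<le> r) \<Longrightarrow> infdist x (A \<union> B) \<le> \<kappa> r"
    for A B gA gB
    unfolding fills_def
  proof (intro ballI impI, rule ccontr)
    fix U V assume U: "U \<in> Dom H" and V: "V \<in> Dom H" and o: "orth H U V"
      and "\<not> ((\<forall>a\<in>A. \<exists>b\<in>B. D U (gA b) a \<le> T) \<or> (\<forall>b\<in>B. \<exists>a\<in>A. D V (gB a) b \<le> T))"
    then obtain a b where a: "a \<in> A" "\<And>b. b \<in> B \<Longrightarrow> T < D U (gA b) a"
      and b: "b \<in> B" "\<And>a. a \<in> A \<Longrightarrow> T < D V (gB a) b" by (meson not_le)
    obtain x where x: "\<And>W. W \<in> Dom H \<Longrightarrow> nest H W U \<Longrightarrow> D W x a \<le> r"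
      "\<And>W. W \<in> Dom H \<Longrightarrow> orth H W U \<Longrightarrow> D W x b \<le> r" "\<And>W. projects U W \<Longrightarrow> R W x U \<le> r"
      using glued[OF U, of a b] by blast
    have "\<exists>y\<in>A \<union> B. D W x y \<le> r0" if W: "W \<in> Dom H" for W
    proof -
      consider "nest H W U" | "orth H W U" | "projects U W" using projectsI U W by blast
      then show ?thesis
      proof cases
        case 1
        then have "D W x a \<le> r0" using x(1)[OF W] unfolding r0_def by force
        then show ?thesis using a by blast
      next
        case 2
        then have "D W x b \<le> r0" using x(2)[OF W] unfolding r0_def by force
        then show ?thesis using b by blast
      next
        case 3
        \<comment> \<open>Failure of density makes \<open>A\<close> wide in \<open>U\<close>, so
          some point of \<open>A\<close> lies near \<open>rel U W\<close>.\<close>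
        have "diam_const c < D U (gA b) a" using a(2)[OF b(1)] T by linarith
        then obtain a' where "a' \<in> A" "R W a' U \<le> rel_const k c"
          using gated_near_rel[OF gA gatedD(1)[OF gA] a(1) _ 3] by blast
        then have "D W x a' \<le> r0" using D_le_R[OF 3, of x a'] x(3)[OF 3] unfolding r0_def by linarith
        then show ?thesis using \<open>a' \<in> A\<close> by blast
      qed
    qed
    then have "infdist x (A \<union> B) \<le> \<kappa> r0" using near[of r0 x] r unfolding r0_def by auto
    then obtain y where y: "y \<in> A \<union> B" "dist x y < \<kappa> r0 + 1" using infdist_leE a(1) by blast
    have J': "D W x y \<le> J" if "W \<in> Dom H" for W
    proof -
      have "K * dist x y \<le> K * (\<bar>\<kappa> r0\<bar> + 1)" using y K by (intro mult_left_mono) auto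
      then show ?thesis using D_lipschitz[OF that, of x y] unfolding J_def by linarith
    qed
    have *: "D W (g y) p \<le> 2 * (J + r) + c"
      if g: "gated k c Y g" and W: "W \<in> Dom H" and p: "p \<in> Y" "D W x p \<le> r" for W Y g p
    proof -
      have "D W y p \<le> J + r"
        using J'[OF W] p D_triangle[OF W, of y p x] D_sym[OF W, of x y] by linarith
      moreover have "D W (g y) p \<le> D W y p + c + D W y p"
        using gatedD(3)[OF g W p(1), of y] D_triangle[OF W, of "g y" p y] D_sym[OF W, of y "g y"] by linarith
      ultimately show ?thesis by argo
    qed
    from y(1) show False
    proof
      assume "y \<in> B"
      then show False using *[OF gA U a(1) x(1)[OF U nest_refl[OF U]]] a(2)[of y] T by linarith
    next
      assume "y \<in> A"
      then show False using *[OF gB V b(1) x(2)[OF V orth_sym[OF U V o]]] b(2)[of y] T by linarith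
    qed
  qed
  then show ?thesis using T(1) by blast
qed

text \<open>Since \<open>x\<close> and \<open>a1\<close> are close in \<open>V\<close> but far in
  \<open>U\<close>, large links puts \<open>x\<close> near \<open>rel U V\<close>. If
  \<open>B\<close> were wide in \<open>U\<close> it would come near \<open>rel U V\<close>, hence
  near \<open>x\<close> in \<open>V\<close>. So \<open>b1\<close> is near \<open>b0\<close> in
  \<open>U\<close>, and \<open>x\<close> is near \<open>a0\<close> there.\<close>

lemma nested_contradiction:
  assumes g: "gated k c B g" and bel: "below U V" and a: "D V x a1 \<le> r" "s < D U x a1" "s < D U x a0"
    and b: "b0 \<in> B" "b1 \<in> B" "D U a0 b0 \<le> d" "D U x b1 \<le> r" "\<And>b. b \<in> B \<Longrightarrow> s < D V x b"
    and s: "K \<le> s" "K * r + K + rel_const k c \<le> s" "r + diam_const c + d \<le> s"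
  shows False
proof -
  have Dm: "U \<in> Dom H" "V \<in> Dom H" using bel unfolding below_def by auto
  note p = below_projects[OF bel]
  have "K \<le> D U x a1" using a s by linarith
  from large_links_near[OF bel this] have *: "R V x U \<le> K * r + K"
    using mult_left_mono[OF a(1), of K] K_bounds by linarith
  have "\<not> diam_const c < D U b1 b0"
  proof
    assume "diam_const c < D U b1 b0"
    then obtain b where "b \<in> B" "R V b U \<le> rel_const k c" using gated_near_rel[OF g b(2,1) _ p] by blast
    then show False using D_le_R[OF p, of x b] * b(5)[of b] s by linarith
  qed
  then show False
    using a(3) b(3,4) s(3) D_triangle[OF Dm(1), of x a0 b1] D_triangle[OF Dm(1), of b1 a0 b0]
      D_sym[OF Dm(1), of a0 b0] by linarith
qed

text \<open>If \<open>x\<close> is near \<open>rel V U\<close> in \<open>U\<close>, all of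
  \<open>A\<close> is far from it there, hence near \<open>rel U V\<close> in \<open>V\<close>;
  dually for \<open>B\<close>. Starting from consistency of \<open>x\<close>, both hold. Then
  \<open>x\<close> is near \<open>a0\<close> in \<open>V\<close>, and so near
  \<open>b0\<close>.\<close>

lemma transverse_contradiction:
  assumes t: "trans U V" and a: "a0 \<in> A" "a1 \<in> A" "D V x a1 \<le> r" "\<And>a. a \<in> A \<Longrightarrow> s < D U x a"
    and b: "b0 \<in> B" "b1 \<in> B" "D U x b1 \<le> r" "\<And>b. b \<in> B \<Longrightarrow> s < D V x b"
    and d: "D V a0 b0 \<le> d" and s: "r + 3 * K + d \<le> s" "0 \<le> r" "0 \<le> d"
  shows False
proof -
  have pUV: "projects U V" and pVU: "projects V U" using t trans_sym trans_projects by blast+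
  have K: "1 \<le> K" by (rule K_bounds)
  have V: "V \<in> Dom H" using projects_Dom pUV by blast
  have swap: "R V y U \<le> K" if "R U x V \<le> r + K" "y \<in> A" for y
    using D_le_R[OF pVU, of x y] that a(4)[of y] s consistent[OF t, of y] K by force
  have swap': "R U y V \<le> K" if "R V x U \<le> r + K" "y \<in> B" for y
    using D_le_R[OF pUV, of x y] that b(4)[of y] s consistent[OF t, of y] K by force
  have xV: "R V x U \<le> r + K"
  proof (cases "R U x V \<le> K")
    case True
    then show ?thesis using swap[OF _ a(2)] R_triangle[OF pUV, of x a1] a(3) s by linarith
  next
    case False
    then show ?thesis using consistent[OF t, of x] s by linarith
  qed
  then have "R U x V \<le> r + K" using swap'[OF _ b(2)] R_triangle[OF pVU, of x b1] b(3) by linarith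
  then have "R V a0 U \<le> K" using swap a(1) by blast
  then have "D V x a0 \<le> r + 2 * K" using D_le_R[OF pUV, of x a0] xV by linarith
  then show False using D_triangle[OF V, of x b0 a0] d b(4)[OF b(1)] s K by linarith
qed

text \<open>A domain \<open>U\<close> in which \<open>x\<close> is far from \<open>A\<close> and a domain \<open>V\<close> in which it is far from \<open>B\<close> cannot
  coexist: filling of squares excludes \<open>U \<bottom> V\<close>, and the remaining relations are excluded because
  \<open>A\<close> and \<open>B\<close> come close to each other.\<close>
lemma fills_imp_close:
  assumes "0 \<le> r" "0 \<le> d"
  shows "\<exists>s\<ge>0. \<forall>A B gA gB a0 b0 x. gated k c A gA \<and> gated k c B gB \<and> fills T A B gA gB \<and>
    a0 \<in> A \<and> b0 \<in> B \<and> (\<forall>U\<in>Dom H. D U a0 b0 \<le> d) \<and> (\<forall>U\<in>Dom H. \<exists>y\<in>A \<union> B. D U x y \<le> r) \<longrightarrow>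
    (\<forall>U\<in>Dom H. \<exists>a\<in>A. D U x a \<le> s) \<or> (\<forall>U\<in>Dom H. \<exists>b\<in>B. D U x b \<le> s)"
proof -
  have K: "1 \<le> K" by (rule K_bounds)
  define Z where "Z = gate_const k c + 2 * d + 2 * E + k"
  define s where "s = r + 3 * K + d + \<bar>T\<bar> + \<bar>Z\<bar> + K * r + \<bar>rel_const k c\<bar> + \<bar>diam_const c\<bar>"
  have "0 \<le> K * r" using K assms by simp
  then have s: "0 \<le> s" "r \<le> s" "r + T + Z \<le> s" "r + 3 * K + d \<le> s" "K \<le> s" "K * r + K + rel_const k c \<le> s"
    "r + diam_const c + d \<le> s"
    unfolding s_def using K assms by linarith+
  have "(\<forall>U\<in>Dom H. \<exists>a\<in>A. D U x a \<le> s) \<or> (\<forall>U\<in>Dom H. \<exists>b\<in>B. D U x b \<le> s)"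
    if gA: "gated k c A gA" and gB: "gated k c B gB" and f: "fills T A B gA gB"
      and ab: "a0 \<in> A" "b0 \<in> B" "\<forall>U\<in>Dom H. D U a0 b0 \<le> d"
      and near: "\<forall>U\<in>Dom H. \<exists>y\<in>A \<union> B. D U x y \<le> r" for A B gA gB a0 b0 x
  proof (rule ccontr)
    assume "\<not> ?thesis"
    then obtain U V where U: "U \<in> Dom H" "\<And>a. a \<in> A \<Longrightarrow> s < D U x a"
      and V: "V \<in> Dom H" "\<And>b. b \<in> B \<Longrightarrow> s < D V x b" by (meson not_le)
    \<comment> \<open>In \<open>U\<close> the nearby point of the union cannot be in
      \<open>A\<close>, so it is in \<open>B\<close>; in \<open>V\<close> the roles are
      exchanged.\<close>
    obtain b1 where b1: "b1 \<in> B" "D U x b1 \<le> r" using near U s by (metis Un_iff not_le order_trans)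
    obtain a1 where a1: "a1 \<in> A" "D V x a1 \<le> r" using near V s by (metis Un_iff not_le order_trans)
    have d': "D U a0 b0 \<le> d" "D V a0 b0 \<le> d" "D U b0 a0 \<le> d" "D V b0 a0 \<le> d"
      using ab U V D_sym by auto
    show False
    proof (rule relation_cases[OF U(1) V(1)])
      assume "U = V"
      then show False using U(2)[OF a1(1)] a1(2) s by simp
    next
      assume bel: "below U V"
      show False
        by (rule nested_contradiction[OF gB bel a1(2) U(2)[OF a1(1)] U(2)[OF ab(1)] ab(2) b1(1) d'(1) b1(2) V(2) s(5-7)])
    next
      assume bel: "below V U"
      show False
        by (rule nested_contradiction[OF gA bel b1(2) V(2)[OF b1(1)] V(2)[OF ab(2)] ab(1) a1(1) d'(4) a1(2) U(2) s(5-7)])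
    next
      assume "trans U V"
      then show False
        by (rule transverse_contradiction[OF _ ab(1) a1 U(2) ab(2) b1 V(2) d'(2) s(4) assms])
    next
      assume "orth H U V"
      then have "orth H V U" using orth_sym U V by blast
      \<comment> \<open>The square is used with \<open>V\<close> first, since \<open>A\<close>
        approaches \<open>x\<close> in \<open>V\<close> and \<open>B\<close> does so in
        \<open>U\<close>. The gates found near \<open>a1\<close> or \<open>b1\<close> are also near
        the other set, which brings \<open>x\<close> too close to it.\<close>
      then consider "\<forall>a\<in>A. \<exists>b\<in>B. D V (gA b) a \<le> T" | "\<forall>b\<in>B. \<exists>a\<in>A. D U (gB a) b \<le> T"
        using f U V unfolding fills_def by blast
      then show False
      proof cases
        case 1
        then obtain b where b: "b \<in> B" "D V (gA b) a1 \<le> T" using a1 by blast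
        obtain b' where b': "b' \<in> B" "D V (gA b) b' \<le> Z"
          using gate_near_other[OF gA gB V(1) ab(1,2) d'(2) b(1)] unfolding Z_def by blast
        then show False
          using V(2)[OF b'(1)] b a1 s D_triangle[OF V(1), of x b' a1] D_triangle[OF V(1), of a1 b' "gA b"]
            D_sym[OF V(1), of a1 "gA b"] by linarith
      next
        case 2
        then obtain a where a: "a \<in> A" "D U (gB a) b1 \<le> T" using b1 by blast
        obtain a' where a': "a' \<in> A" "D U (gB a) a' \<le> Z"
          using gate_near_other[OF gB gA U(1) ab(2,1) d'(3) a(1)] unfolding Z_def by blast
        then show False
          using U(2)[OF a'(1)] a b1 s D_triangle[OF U(1), of x a' b1] D_triangle[OF U(1), of b1 a' "gB a"]
            D_sym[OF U(1), of b1 "gB a"] by linarith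
      qed
    qed
  qed
  then show ?thesis using s(1) by blast
qed

section \<open>From chosen coordinates back to projection sets\<close>

lemma prset_CS: "U \<in> Dom H \<Longrightarrow> prset H U Y \<subseteq> CS H U"
  and coord_prset: "U \<in> Dom H \<Longrightarrow> y \<in> Y \<Longrightarrow> coord U y \<in> prset H U Y"
  unfolding prset_def using pr_props(2) coord_pr by blast+

lemma near_coord: "U \<in> Dom H \<Longrightarrow> p \<in> pr H U x \<Longrightarrow> q \<in> CS H U \<Longrightarrow>
    dC H U q (coord U x) \<le> dC H U q p + E \<and> dC H U (coord U x) q \<le> dC H U p q + E"
  using hyperbolic_space.triangle[OF space, of U q p "coord U x"]
    hyperbolic_space.triangle[OF space, of U "coord U x" p q]
    hyperbolic_space.sym[OF space, of U "coord U x" p] coord_near coord_CS pr_props(2) by fastforce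

lemma dU_le:
  assumes "U \<in> Dom H" "y \<in> Y" "D U x y \<le> r"
  shows "dU H U {x} Y \<le> r"
proof -
  have "dU H U {x} Y \<le> dC H U (coord U x) (coord U y)"
    unfolding dU_def
    by (rule csetdist_le[OF metric[OF assms(1)]]) (use assms in \<open>auto intro: prset_CS[THEN subsetD] coord_prset\<close>)
  then show ?thesis using assms unfolding D_def by linarith
qed

text \<open>The summand 1 pays for an infimum that need not be attained, \<open>2 * E\<close> for
  the passage to chosen coordinates.\<close>

lemma dU_leE:
  assumes "U \<in> Dom H" "Y \<noteq> {}" "dU H U {x} Y \<le> r"
  obtains y where "y \<in> Y" "D U x y \<le> r + 1 + 2 * E"
proof -
  have "prset H U {x} \<noteq> {}" "prset H U Y \<noteq> {}" using assms coord_prset by blast+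
  then obtain p q where p: "p \<in> prset H U {x}" and q: "q \<in> prset H U Y" and l: "dC H U p q < r + 1"
    using csetdist_lessE[of "prset H U {x}" "prset H U Y" "dC H U" "r + 1"] assms(3) unfolding dU_def by force
  obtain y where y: "y \<in> Y" "q \<in> pr H U y" and p': "p \<in> pr H U x" using p q unfolding prset_def by blast
  have "D U x y \<le> dC H U p q + 2 * E"
    using near_coord[OF assms(1) p' coord_CS[OF assms(1), of y]] near_coord[OF assms(1) y(2), of p]
      p' pr_props(2)[OF assms(1)] unfolding D_def by force
  then show ?thesis using that[of y] y l by linarith
qed

lemma hier_qconvex_infdist:
  assumes "hier_qconvex H \<kappa> Y" "0 \<le> r" "\<forall>U\<in>Dom H. \<exists>y\<in>Y. D U x y \<le> r"
  shows "infdist x Y \<le> \<kappa> r"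
proof -
  have "\<forall>U\<in>Dom H. dU H U {x} Y \<le> r" using assms(3) dU_le by blast
  moreover have "\<forall>x R. R \<ge> 0 \<longrightarrow> (\<forall>U\<in>Dom H. dU H U {x} Y \<le> R) \<longrightarrow> infdist x Y \<le> \<kappa> R"
    using assms(1) unfolding hier_qconvex_def by (elim conjE)
  ultimately show ?thesis using assms(2) by simp
qed

text \<open>The coordinate of \<open>g x\<close> is within \<open>C\<close> of a coarse closest
  point of the projection of \<open>A\<close>. The summand 1 is the slack in \<open>cpp\<close>, and
  \<open>2 * E\<close> comes from the choice of points in projections.\<close>

lemma gatedI:
  assumes A: "hier_qconvex H \<kappa> A" and g: "is_gate H A C g"
  shows "gated (\<kappa> 0 + E) (2 * E + C + 1) A g"
  unfolding gated_def
proof (intro conjI allI ballI)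
  show "g x \<in> A" for x using g unfolding is_gate_def by blast
  fix U assume U: "U \<in> Dom H"
  have qc: "quasiconvex (CS H U) (dC H U) (\<kappa> 0) (prset H U A)"
    using A U unfolding hier_qconvex_def by blast
  show "quasiconvex (CS H U) (dC H U) (\<kappa> 0 + E) (coord U ` A)"
    unfolding quasiconvex_def
  proof (intro conjI ballI allI impI)
    show "coord U ` A \<subseteq> CS H U" using coord_CS[OF U] by blast
    fix a b \<gamma> t assume a: "a \<in> coord U ` A" and b: "b \<in> coord U ` A"
      and \<gamma>: "geodesic_seg (CS H U) (dC H U) \<gamma> a b" and t: "t \<in> {0..dC H U a b}"
    have ab: "a \<in> prset H U A" "b \<in> prset H U A" using a b coord_prset[OF U] by blast+
    then have "a \<in> CS H U" "b \<in> CS H U" using prset_CS[OF U] by blast+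
    then have \<gamma>t: "\<gamma> t \<in> CS H U" using hyperbolic_space.geodesic_segD(1)[OF space[OF U] \<gamma>] t by blast
    obtain y where y: "y \<in> prset H U A" "dC H U (\<gamma> t) y \<le> \<kappa> 0"
      using qc ab \<gamma> t unfolding quasiconvex_def by blast
    then obtain a' where a': "a' \<in> A" "y \<in> pr H U a'" unfolding prset_def by blast
    then have "dC H U (\<gamma> t) (coord U a') \<le> \<kappa> 0 + E" using near_coord[OF U a'(2) \<gamma>t] y by linarith
    then show "\<exists>y\<in>coord U ` A. dC H U (\<gamma> t) y \<le> \<kappa> 0 + E" using a' by blast
  qed
  fix x a assume a: "a \<in> A"
  have "dense_in (dC H U) C (cpp (dC H U) (prset H U A) (pr H U x)) (pr H U (g x))"
    using g U unfolding is_gate_def hausdorff_le_def by blast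
  then obtain y z where y: "y \<in> prset H U A" "dC H U y (coord U (g x)) \<le> C"
    and z: "z \<in> pr H U x" "dC H U z y \<le> csetdist (dC H U) {z} (prset H U A) + 1"
    using coord_pr[OF U, of "g x"] unfolding dense_in_def cpp_def by blast
  have zC: "z \<in> CS H U" and yC: "y \<in> CS H U" using z y pr_props(2)[OF U] prset_CS[OF U] by blast+
  have "csetdist (dC H U) {z} (prset H U A) \<le> dC H U z (coord U a)"
    by (rule csetdist_le[OF metric[OF U]]) (use zC prset_CS[OF U] coord_prset[OF U a] in auto)
  moreover have "dC H U z (coord U a) \<le> E + D U x a"
    using hyperbolic_space.triangle[OF space[OF U] zC coord_CS[OF U, of x] coord_CS[OF U, of a]]
      coord_near[OF U z(1)] unfolding D_def by linarith
  moreover have "D U x (g x) \<le> dC H U z (coord U (g x)) + E"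
    using near_coord[OF U z(1) coord_CS[OF U, of "g x"]] unfolding D_def by blast
  moreover have "dC H U z (coord U (g x)) \<le> dC H U z y + C"
    using hyperbolic_space.triangle[OF space[OF U] zC yC coord_CS[OF U], of "g x"] y by linarith
  ultimately show "D U x (g x) \<le> D U x a + (2 * E + C + 1)" using z(2) by linarith
qed

lemma dense_in_prsetI:
  assumes U: "U \<in> Dom H" and d: "\<And>q. q \<in> Y \<Longrightarrow> \<exists>p\<in>X. D U p q \<le> T"
  shows "dense_in (dC H U) (T + E) (prset H U X) (prset H U Y)"
  unfolding dense_in_def
proof
  fix z assume "z \<in> prset H U Y"
  then obtain q where q: "q \<in> Y" "z \<in> pr H U q" unfolding prset_def by blast
  obtain p where p: "p \<in> X" "D U p q \<le> T" using d q by blast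
  have z: "z \<in> CS H U" using q pr_props(2)[OF U] by blast
  have "dC H U (coord U p) z \<le> T + E"
    using hyperbolic_space.triangle[OF space[OF U] coord_CS[OF U] coord_CS[OF U] z, of p q] p(2)
      coord_near[OF U q(2)] hyperbolic_space.sym[OF space[OF U] z coord_CS[OF U], of q] unfolding D_def by linarith
  then show "\<exists>p\<in>prset H U X. dC H U p z \<le> T + E" using coord_prset[OF U p(1)] by blast
qed

lemma dense_in_prsetD:
  assumes U: "U \<in> Dom H" and d: "dense_in (dC H U) T (prset H U X) (prset H U Y)" and q: "q \<in> Y"
  shows "\<exists>p\<in>X. D U p q \<le> T + E"
proof -
  obtain z where z: "z \<in> prset H U X" "dC H U z (coord U q) \<le> T"
    using d coord_prset[OF U q] unfolding dense_in_def by blast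
  then obtain p where p: "p \<in> X" "z \<in> pr H U p" unfolding prset_def by blast
  have "D U p q \<le> T + E" unfolding D_def using near_coord[OF U p(2) coord_CS[OF U, of q]] z by linarith
  then show ?thesis using p by blast
qed

lemma fills_imp_fill_all_squares: "fills T A B gA gB \<Longrightarrow> fill_all_squares H (T + E) A B gA gB"
  unfolding fill_all_squares_def fills_def
proof (intro ballI impI)
  fix U V assume U: "U \<in> Dom H" and V: "V \<in> Dom H" and o: "orth H U V"
    and f: "\<forall>U\<in>Dom H. \<forall>V\<in>Dom H. orth H U V \<longrightarrow>
     (\<forall>a\<in>A. \<exists>b\<in>B. D U (gA b) a \<le> T) \<or> (\<forall>b\<in>B. \<exists>a\<in>A. D V (gB a) b \<le> T)"
  then consider "\<forall>a\<in>A. \<exists>b\<in>B. D U (gA b) a \<le> T" | "\<forall>b\<in>B. \<exists>a\<in>A. D V (gB a) b \<le> T" by blast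
  then show "dense_in (dC H U) (T + E) (prset H U (gA ` B)) (prset H U A) \<or>
      dense_in (dC H V) (T + E) (prset H V (gB ` A)) (prset H V B)"
    using dense_in_prsetI[OF U, of A "gA ` B" T] dense_in_prsetI[OF V, of B "gB ` A" T]
    by cases auto
qed

lemma fill_all_squares_imp_fills: "fill_all_squares H T A B gA gB \<Longrightarrow> fills (T + E) A B gA gB"
  unfolding fills_def
proof (intro ballI impI)
  fix U V assume U: "U \<in> Dom H" and V: "V \<in> Dom H" and o: "orth H U V"
    and f: "fill_all_squares H T A B gA gB"
  then consider "dense_in (dC H U) T (prset H U (gA ` B)) (prset H U A)"
    | "dense_in (dC H V) T (prset H V (gB ` A)) (prset H V B)"
    unfolding fill_all_squares_def by blast
  then show "(\<forall>a\<in>A. \<exists>b\<in>B. D U (gA b) a \<le> T + E) \<or> (\<forall>b\<in>B. \<exists>a\<in>A. D V (gB a) b \<le> T + E)"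
    using dense_in_prsetD[OF U, of T "gA ` B" A] dense_in_prsetD[OF V, of T "gB ` A" B]
    by cases auto
qed

lemma union_qconvex_imp_fill:
  "\<exists>T\<ge>0. \<forall>A B gA gB. hier_qconvex H \<kappa> A \<and> hier_qconvex H \<kappa> B \<and> hier_qconvex H \<kappa>' (A \<union> B) \<and>
        is_gate H A C gA \<and> is_gate H B C gB \<longrightarrow> fill_all_squares H T A B gA gB"
proof -
  obtain T where T: "0 \<le> T" and fill: "\<forall>A B gA gB.
    gated (\<kappa> 0 + E) (2 * E + C + 1) A gA \<and> gated (\<kappa> 0 + E) (2 * E + C + 1) B gB \<and>
    (\<forall>x r. 0 \<le> r \<longrightarrow> (\<forall>U\<in>Dom H. \<exists>y\<in>A \<union> B. D U x y \<le> r) \<longrightarrow> infdist x (A \<union> B) \<le> \<kappa>' r) \<longrightarrow>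
    fills T A B gA gB"
    using union_imp_fills by blast
  have "fill_all_squares H (T + E) A B gA gB"
    if "hier_qconvex H \<kappa> A" "hier_qconvex H \<kappa> B" and h: "hier_qconvex H \<kappa>' (A \<union> B)"
      and "is_gate H A C gA" "is_gate H B C gB" for A B gA gB
  proof -
    have "\<forall>x r. 0 \<le> r \<longrightarrow> (\<forall>U\<in>Dom H. \<exists>y\<in>A \<union> B. D U x y \<le> r) \<longrightarrow> infdist x (A \<union> B) \<le> \<kappa>' r"
      by (intro allI impI) (rule hier_qconvex_infdist[OF h])
    from fill[rule_format, OF conjI[OF gatedI[OF that(1,4)] conjI[OF gatedI[OF that(2,5)] this]]]
    show ?thesis by (rule fills_imp_fill_all_squares)
  qed
  then show ?thesis using T E_pos by (intro exI[of _ "T + E"]) auto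
qed

lemma quasiconvex_mono: "quasiconvex M d k Y \<Longrightarrow> k \<le> k' \<Longrightarrow> quasiconvex M d k' Y"
  unfolding quasiconvex_def by (meson order_trans)

text \<open>Quasiconvexity of the projections is \<open>quasiconvex_Un\<close>. A point
  coordinatewise close to the union is so to \<open>A\<close> or to \<open>B\<close> by
  \<open>fills_imp_close\<close>, and then hierarchical quasiconvexity of that set applies.\<close>

lemma fill_imp_union_qconvex:
  "\<exists>\<kappa>'. \<forall>A B gA gB. hier_qconvex H \<kappa> A \<and> hier_qconvex H \<kappa> B \<and> setdist A B \<le> \<Delta> \<and>
        is_gate H A C gA \<and> is_gate H B C gB \<and> fill_all_squares H T A B gA gB \<longrightarrow>
        hier_qconvex H \<kappa>' (A \<union> B)"
proof -
  define d where "d = K * (\<bar>\<Delta>\<bar> + 1) + K"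
  define k where "k = \<kappa> 0 + E"
  define c where "c = 2 * E + C + 1"
  have K: "1 \<le> K" by (rule K_bounds)
  then have "0 \<le> K * (\<bar>\<Delta>\<bar> + 1)" by simp
  then have d: "0 \<le> d" unfolding d_def using K by simp
  \<comment> \<open>The quantifiers over the sets, the gates and the points stand inside, so the
    function \<open>s\<close> chosen from \<open>close\<close>, and with it
    \<open>\<kappa>'\<close>, depends on the constants alone.\<close>
  define close where "close r s \<longleftrightarrow> 0 \<le> s \<and> (\<forall>A B gA gB a0 b0 x.
      gated k c A gA \<and> gated k c B gB \<and> fills (T + E) A B gA gB \<and>
      a0 \<in> A \<and> b0 \<in> B \<and> (\<forall>U\<in>Dom H. D U a0 b0 \<le> d) \<and> (\<forall>U\<in>Dom H. \<exists>y\<in>A \<union> B. D U x y \<le> r) \<longrightarrow>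
      (\<forall>U\<in>Dom H. \<exists>a\<in>A. D U x a \<le> s) \<or> (\<forall>U\<in>Dom H. \<exists>b\<in>B. D U x b \<le> s))" for r s
  have "\<forall>r\<in>{0..}. \<exists>s. close r s" using fills_imp_close[OF _ d] unfolding close_def by auto
  then obtain s where s: "\<And>r. 0 \<le> r \<Longrightarrow> close r (s r)" by (metis atLeast_iff)
  define \<kappa>' where "\<kappa>' r = max 0 (\<kappa> (s (r + 1 + 2 * E))) + \<bar>4 * E + 2 * d + \<kappa> 0\<bar>" for r
  have "hier_qconvex H \<kappa>' (A \<union> B)"
    if A: "hier_qconvex H \<kappa> A" and B: "hier_qconvex H \<kappa> B" and sd: "setdist A B \<le> \<Delta>"
      and gA: "is_gate H A C gA" and gB: "is_gate H B C gB" and f: "fill_all_squares H T A B gA gB"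
    for A B gA gB
  proof -
    \<comment> \<open>Existence of gates excludes empty sets, so \<open>setdist\<close> and
      \<open>infdist\<close> do not take their default value 0.\<close>
    have ne: "A \<noteq> {}" "B \<noteq> {}" using gA gB unfolding is_gate_def by auto
    obtain a0 b0 where ab: "a0 \<in> A" "b0 \<in> B" "dist a0 b0 < \<bar>\<Delta>\<bar> + 1"
      using setdist_ltE[OF _ ne, of "\<bar>\<Delta>\<bar> + 1"] sd by force
    have dd: "D U a0 b0 \<le> d" if "U \<in> Dom H" for U
      using D_lipschitz[OF that, of a0 b0] mult_left_mono[of "dist a0 b0" "\<bar>\<Delta>\<bar> + 1" K] ab(3) K
      unfolding d_def by linarith
    show ?thesis
      unfolding hier_qconvex_def
    proof (intro conjI ballI allI impI)
      show "0 \<le> \<kappa>' r" for r unfolding \<kappa>'_def by simp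
      show "quasiconvex (CS H U) (dC H U) (\<kappa>' 0) (prset H U (A \<union> B))" if U: "U \<in> Dom H" for U
      proof -
        have "quasiconvex (CS H U) (dC H U) (4 * E + 2 * d + \<kappa> 0) (prset H U A \<union> prset H U B)"
          using A B U dd[OF U] coord_prset[OF U] ab
          by (intro hyperbolic_space.quasiconvex_Un[OF space[OF U], of _ _ _ "coord U a0" "coord U b0"])
            (auto simp: hier_qconvex_def D_def)
        moreover have "prset H U A \<union> prset H U B = prset H U (A \<union> B)" unfolding prset_def by blast
        ultimately show ?thesis
          using quasiconvex_mono[of "CS H U" "dC H U" "4 * E + 2 * d + \<kappa> 0" "prset H U (A \<union> B)" "\<kappa>' 0"]
          unfolding \<kappa>'_def by simp
      qed
      fix x r assume r: "(0::real) \<le> r" and near: "\<forall>U\<in>Dom H. dU H U {x} (A \<union> B) \<le> r"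
      define r' where "r' = r + 1 + 2 * E"
      have r': "0 \<le> r'" using r E_pos unfolding r'_def by simp
      have s0: "0 \<le> s r'" using s[OF r'] unfolding close_def by (elim conjE)
      have "\<forall>U\<in>Dom H. \<exists>y\<in>A \<union> B. D U x y \<le> r'"
        using near ne dU_leE[of _ "A \<union> B" x r] unfolding r'_def by (metis Un_empty)
      then consider "\<forall>U\<in>Dom H. \<exists>a\<in>A. D U x a \<le> s r'" | "\<forall>U\<in>Dom H. \<exists>b\<in>B. D U x b \<le> s r'"
        using s[OF r'] gatedI[OF A gA] gatedI[OF B gB] fill_all_squares_imp_fills[OF f] ab(1,2) dd
        unfolding close_def k_def c_def by blast
      then have "infdist x (A \<union> B) \<le> \<kappa> (s r')"
      proof cases
        case 1
        then have "infdist x A \<le> \<kappa> (s r')" by (rule hier_qconvex_infdist[OF A s0])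
        then show ?thesis using infdist_mono[of A "A \<union> B" x] ne by simp
      next
        case 2
        then have "infdist x B \<le> \<kappa> (s r')" by (rule hier_qconvex_infdist[OF B s0])
        then show ?thesis using infdist_mono[of B "A \<union> B" x] ne by simp
      qed
      then show "infdist x (A \<union> B) \<le> \<kappa>' r" unfolding \<kappa>'_def r'_def by linarith
    qed
  qed
  then show ?thesis by blast
qed

end

theorem theorem4p10:
  fixes H :: "('d, 'x::metric_space, 'c) hstruct"
  assumes "HHS H"
  shows
    "(\<forall>\<kappa> C A B gA gB.
        hier_qconvex H \<kappa> A \<and> hier_qconvex H \<kappa> B \<and> is_gate H A C gA \<and> is_gate H B C gB \<longrightarrow>
        ((\<exists>T\<ge>0. fill_all_squares H T A B gA gB) \<longleftrightarrow> (\<exists>\<kappa>'. hier_qconvex H \<kappa>' (A \<union> B))))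
   \<and> (\<forall>\<kappa> \<kappa>' C. \<exists>T\<ge>0. \<forall>A B gA gB.
        hier_qconvex H \<kappa> A \<and> hier_qconvex H \<kappa> B \<and> hier_qconvex H \<kappa>' (A \<union> B) \<and>
        is_gate H A C gA \<and> is_gate H B C gB \<longrightarrow> fill_all_squares H T A B gA gB)
   \<and> (\<forall>\<kappa> D T C. \<exists>\<kappa>'. \<forall>A B gA gB.
        hier_qconvex H \<kappa> A \<and> hier_qconvex H \<kappa> B \<and> setdist A B \<le> D \<and>
        is_gate H A C gA \<and> is_gate H B C gB \<and> fill_all_squares H T A B gA gB \<longrightarrow>
        hier_qconvex H \<kappa>' (A \<union> B))"
proof -
  obtain E \<theta> where "HHS_with H E \<theta>" using assms unfolding HHS_def by blast
  then interpret hier H E \<theta> by unfold_locales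
  show ?thesis
  proof (intro conjI allI)
    fix \<kappa> C A B gA gB
    show "hier_qconvex H \<kappa> A \<and> hier_qconvex H \<kappa> B \<and> is_gate H A C gA \<and> is_gate H B C gB \<longrightarrow>
        ((\<exists>T\<ge>0. fill_all_squares H T A B gA gB) \<longleftrightarrow> (\<exists>\<kappa>'. hier_qconvex H \<kappa>' (A \<union> B)))"
      (is "?hyp \<longrightarrow> ?fill \<longleftrightarrow> ?qc")
    proof (intro impI iffI)
      assume h: ?hyp and ?fill
      then obtain T where "fill_all_squares H T A B gA gB" by blast
      \<comment> \<open>For a single pair of sets the distance itself serves as the bound.\<close>
      then show ?qc using fill_imp_union_qconvex[of \<kappa> "setdist A B" C T] h by blast
    next
      assume h: ?hyp and ?qc
      then obtain \<kappa>' where "hier_qconvex H \<kappa>' (A \<union> B)" by blast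
      then show ?fill using union_qconvex_imp_fill[of \<kappa> \<kappa>' C] h by blast
    qed
  qed (fact union_qconvex_imp_fill fill_imp_union_qconvex)+
qed

end
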